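(* Let $S$ be a local ring, let $x$ be an exact zero-divisor in $S$, and let $R=S/(x)$. Then for every finitely generated $R$-module $M$ and every integer $n\ge 0$, $$\beta^R_n(M)-\sum_{i=0}^{n-2}\beta^R_i(M)\;\le\;\beta^S_n(M)\;\le\;\sum_{i=0}^{n}\beta^R_i(M).$$ Consequently, $\operatorname{cx}_S(M)\le \operatorname{cx}_R(M)+1$.
   Context: "Local ring" means commutative Noetherian local ring. An element $x$ of a local ring $S$ is an exact zero-divisor if $x$ is nonzero, $x$ belongs to the maximal ideal of $S$, and there is $y\in S$ with $\operatorname{ann}_S(x)=(y)$ and $\operatorname{ann}_S(y)=(x)$. Every $R$-module is regarded as an $S$-module via $S\to R$. For a local ring $A$ with residue field $k$ and a finitely generated $A$-module $M$, the $n$th Betti number is $\beta^A_n(M)=\dim_k\operatorname{Tor}^A_n(M,k)$, i.e. the rank of the $n$th free module in a minimal free resolution of $M$ over $A$; Betti numbers with negative index are zero, and empty sums are zero. The complexity of $M$ is $$\operatorname{cx}_A(M)=\inf\{t\in\{0,1,2,\dots\}\mid \exists\, a\in\mathbb{R}\text{ such that }\beta^A_n(M)\le a n^{t-1}\text{ for all } n\ge 1\},$$ with value $\infty$ if no such $t$ exists. *)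

theory Defs
  imports
    "Jordan_Normal_Form.Missing_VectorSpace"
    "HOL-Algebra.Ring_Divisibility"
    "HOL-Algebra.QuotRing"
    "HOL-Library.Extended_Nat"
    Complex_Main
begin

section \<open>Local rings and exact zero-divisors\<close>

locale noetherian_local_ring = cring R + noetherian_ring R for R (structure) +
  assumes ex1_maximalideal: "\<exists>!I. maximalideal I R"

definition max_ideal :: "('a, 'r) ring_scheme \<Rightarrow> 'a set"
  where "max_ideal A = (THE I. maximalideal I A)"

definition annihilator :: "('a, 'r) ring_scheme \<Rightarrow> 'a \<Rightarrow> 'a set"
  where "annihilator A x = {a \<in> carrier A. a \<otimes>\<^bsub>A\<^esub> x = \<zero>\<^bsub>A\<^esub>}"

definition exact_zero_divisor :: "('a, 'r) ring_scheme \<Rightarrow> 'a \<Rightarrow> bool"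
  where "exact_zero_divisor A x \<longleftrightarrow>
    x \<noteq> \<zero>\<^bsub>A\<^esub> \<and> x \<in> max_ideal A \<and>
    (\<exists>y \<in> carrier A. annihilator A x = PIdl\<^bsub>A\<^esub> y \<and> annihilator A y = PIdl\<^bsub>A\<^esub> x)"

section \<open>Modules\<close>

definition finitely_generated :: "('a, 'r) ring_scheme \<Rightarrow> ('a, 'b, 'm) module_scheme \<Rightarrow> bool"
  where "finitely_generated A M \<longleftrightarrow>
    (\<exists>G. finite G \<and> G \<subseteq> carrier M \<and> LinearCombinations.module.span A M G = carrier M)"

text \<open>
  Only the scalar multiplication changes, but the scalar type changes with it, so the record
  has to be rebuilt.
\<close>

definition restrict_scalars ::
    "('a \<Rightarrow> 'c) \<Rightarrow> ('c, 'b, 'm) module_scheme \<Rightarrow> ('a, 'b) module"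
  where "restrict_scalars f M =
    \<lparr>carrier = carrier M, monoid.mult = monoid.mult M, one = one M, zero = zero M, add = add M,
     smult = (\<lambda>a v. f a \<odot>\<^bsub>M\<^esub> v)\<rparr>"

abbreviation free_module :: "('a, 'r) ring_scheme \<Rightarrow> nat \<Rightarrow> ('a, nat \<Rightarrow> 'a) module"
  where "free_module A n \<equiv> ring.func_space A {..<n}"

section \<open>Minimal free resolutions, Betti numbers and complexity\<close>

text \<open>
  An exact complex \<open>\<dots> \<rightarrow> A\<^sup>b\<^sup>2 \<rightarrow> A\<^sup>b\<^sup>1 \<rightarrow> A\<^sup>b\<^sup>0 \<rightarrow> M \<rightarrow> 0\<close> with augmentation \<open>\<epsilon>\<close> and
  differentials \<open>d n : A\<^bsup>b (n + 1)\<^esup> \<rightarrow> A\<^bsup>b n\<^esup>\<close>.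
\<close>

definition free_resolution ::
    "('a, 'r) ring_scheme \<Rightarrow> ('a, 'b, 'm) module_scheme \<Rightarrow> (nat \<Rightarrow> nat) \<Rightarrow>
     (nat \<Rightarrow> (nat \<Rightarrow> 'a) \<Rightarrow> (nat \<Rightarrow> 'a)) \<Rightarrow> ((nat \<Rightarrow> 'a) \<Rightarrow> 'b) \<Rightarrow> bool"
  where "free_resolution A M b d \<epsilon> \<longleftrightarrow>
    \<epsilon> \<in> LinearCombinations.module_hom A (free_module A (b 0)) M \<and>
    (\<forall>n. d n \<in> LinearCombinations.module_hom A (free_module A (b (Suc n))) (free_module A (b n))) \<and>
    \<epsilon> ` carrier (free_module A (b 0)) = carrier M \<and>
    d 0 ` carrier (free_module A (b 1)) = a_kernel (free_module A (b 0)) M \<epsilon> \<and>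
    (\<forall>n. d (Suc n) ` carrier (free_module A (b (Suc (Suc n)))) =
         a_kernel (free_module A (b (Suc n))) (free_module A (b n)) (d n))"

text \<open>
  Minimality says that the image of \<open>d n\<close> lies in \<open>\<mm> A\<^bsup>b n\<^esup>\<close>, the submodule of
  those vectors all of whose coordinates lie in the maximal ideal \<open>\<mm>\<close>.
\<close>

definition minimal_free_resolution ::
    "('a, 'r) ring_scheme \<Rightarrow> ('a, 'b, 'm) module_scheme \<Rightarrow> (nat \<Rightarrow> nat) \<Rightarrow>
     (nat \<Rightarrow> (nat \<Rightarrow> 'a) \<Rightarrow> (nat \<Rightarrow> 'a)) \<Rightarrow> ((nat \<Rightarrow> 'a) \<Rightarrow> 'b) \<Rightarrow> bool"
  where "minimal_free_resolution A M b d \<epsilon> \<longleftrightarrow>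
    free_resolution A M b d \<epsilon> \<and>
    (\<forall>n. \<forall>v \<in> carrier (free_module A (b (Suc n))). \<forall>i < b n. d n v i \<in> max_ideal A)"

text \<open>
  A finitely generated module over a Noetherian local ring has a minimal free resolution, and
  the ranks occurring in it do not depend on the choice, so the description is well defined.
\<close>

definition betti :: "('a, 'r) ring_scheme \<Rightarrow> ('a, 'b, 'm) module_scheme \<Rightarrow> nat \<Rightarrow> nat"
  where "betti A M n = (THE r. \<exists>b d \<epsilon>. minimal_free_resolution A M b d \<epsilon> \<and> r = b n)"

text \<open>The exponent \<open>t - 1\<close> is an integer (it is \<open>-1\<close> for \<open>t = 0\<close>); in \<^typ>\<open>enat\<close>, the
  infimum of the empty set is \<open>\<infinity>\<close>.\<close>

definition complexity :: "('a, 'r) ring_scheme \<Rightarrow> ('a, 'b, 'm) module_scheme \<Rightarrow> enat"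
  where "complexity A M =
    Inf {enat t | t. \<exists>a::real. \<forall>n\<ge>1. real (betti A M n) \<le> a * real n powi (int t - 1)}"

end

theory Submission
  imports Defs
begin

text \<open>
  Betti numbers over \<open>S\<close> are compared with those over \<open>R = S/(x)\<close> one syzygy at a time. Let
  \<open>N\<close> be the kernel of a minimal cover \<open>R\<^sup>b \<rightarrow> M\<close> over \<open>R\<close>, so that
  \<open>\<beta>\<^sup>R\<^sub>n(N) = \<beta>\<^sup>R\<^sub>n\<^sub>+\<^sub>1(M)\<close> and \<open>b = \<beta>\<^sup>R\<^sub>0(M)\<close>. Multiplication by \<open>x\<close> and by its
  partner \<open>y\<close> in turn gives an \<open>S\<close>-free resolution of \<open>R\<^sup>b\<close> with all ranks equal to \<open>b\<close>
  (\<open>periodic_resolution\<close>). If \<open>P\<close> is the minimal \<open>S\<close>-resolution of \<open>N\<close>, with ranks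
  \<open>p\<^sub>n\<close>, then lifting \<open>N \<rightarrow> R\<^sup>b\<close> to resolutions and taking the mapping cone gives an
  \<open>S\<close>-free resolution \<open>C\<close> of \<open>M\<close> with ranks \<open>b\<close> and \<open>b + p\<^sub>n\<close> in degrees \<open>0\<close> and
  \<open>n + 1\<close> (\<open>cone_resolution\<close>). It need not be minimal. Writing \<open>t\<^sub>n = \<beta>\<^sup>S\<^sub>n(M)\<close>, the claim
  follows by induction on \<open>n\<close> from
  \<open>t\<^sub>0 = b\<close>, \<open>t\<^sub>n\<^sub>+\<^sub>1 \<le> b + p\<^sub>n\<close>, \<open>p\<^sub>n \<le> t\<^sub>n\<^sub>+\<^sub>1 + b\<close> and \<open>p\<^sub>0 \<le> t\<^sub>1\<close>
  (\<open>syzygy_step\<close>, \<open>betti_bounds_step\<close>). These are the inequalities that the long exact sequence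
  of \<open>Tor\<^sup>S(-, k)\<close> for \<open>0 \<rightarrow> N \<rightarrow> R\<^sup>b \<rightarrow> M \<rightarrow> 0\<close> would give.

  \<open>Tor\<close> itself is avoided. Any two free resolutions of a module are homotopy equivalent, so a
  comparison map \<open>\<alpha>\<close> from \<open>C\<close> is injective on homology modulo the maximal ideal \<open>\<mm>\<close>: a
  vector \<open>v\<close> with \<open>\<alpha> v\<close> and \<open>d v\<close> in \<open>\<mm>\<close> is a boundary modulo \<open>\<mm>\<close>
  (\<open>tor_injective\<close>). On the other hand fewer linear equations than unknowns always have a
  solution modulo \<open>\<mm>\<close> that is not zero modulo \<open>\<mm>\<close> (\<open>underdetermined\<close>). Together they turn
  into rank inequalities: for a minimal source every boundary is zero modulo \<open>\<mm>\<close>, so a minimal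
  resolution has the smallest ranks of all free resolutions (\<open>minimal_rank_le\<close>), which also makes
  Betti numbers well defined; for the cone, the vectors of its \<open>P\<close>-part that the lift
  of \<open>N \<rightarrow> R\<^sup>b\<close> sends into \<open>\<mm>\<close> are detected by \<open>\<alpha>\<close>, and being sent into \<open>\<mm>\<close>
  costs at most \<open>b\<close> equations, so \<open>p\<^sub>n \<le> t\<^sub>n\<^sub>+\<^sub>1 + b\<close> (\<open>cone_ranks\<close>). For \<open>n = 0\<close> these
  equations hold automatically, because \<open>N \<subseteq> \<mm>R\<^sup>b\<close>; this is where the lower bound gains its
  sum up to \<open>n - 2\<close> instead of \<open>n - 1\<close>.

  The bound on the complexity follows from the upper bounds: summing a sequence raises its order of
  growth by at most one.
\<close>

section \<open>Linear maps out of free modules\<close>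

abbreviation lin ::
    "('a, 'r) ring_scheme \<Rightarrow> ('a, 'b, 'm) module_scheme \<Rightarrow> ('a, 'c, 'n) module_scheme \<Rightarrow> ('b \<Rightarrow> 'c) set"
  where "lin \<equiv> LinearCombinations.module_hom"

lemma linI:
  assumes "\<And>v. v \<in> carrier X \<Longrightarrow> f v \<in> carrier Y"
    and "\<And>v w. v \<in> carrier X \<Longrightarrow> w \<in> carrier X \<Longrightarrow> f (v \<oplus>\<^bsub>X\<^esub> w) = f v \<oplus>\<^bsub>Y\<^esub> f w"
    and "\<And>a v. a \<in> carrier A \<Longrightarrow> v \<in> carrier X \<Longrightarrow> f (a \<odot>\<^bsub>X\<^esub> v) = a \<odot>\<^bsub>Y\<^esub> f v"
  shows "f \<in> lin A X Y"
  using assms unfolding LinearCombinations.module_hom_def by auto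

lemma lin_closed: "f \<in> lin A X Y \<Longrightarrow> v \<in> carrier X \<Longrightarrow> f v \<in> carrier Y"
  unfolding LinearCombinations.module_hom_def by auto

lemma lin_comp: "f \<in> lin A X Y \<Longrightarrow> g \<in> lin A Y Z \<Longrightarrow> (\<lambda>v. g (f v)) \<in> lin A X Z"
  unfolding LinearCombinations.module_hom_def by (auto simp: Pi_iff)

lemma lin_mod_hom:
  "Module.module A X \<Longrightarrow> Module.module A Y \<Longrightarrow> f \<in> lin A X Y \<Longrightarrow> mod_hom A X Y f"
  by (simp add: mod_hom.intro mod_hom_axioms.intro)

lemma lin_zero:
  "Module.module A X \<Longrightarrow> Module.module A Y \<Longrightarrow> f \<in> lin A X Y \<Longrightarrow> f \<zero>\<^bsub>X\<^esub> = \<zero>\<^bsub>Y\<^esub>"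
  by (rule mod_hom.f0_is_0[OF lin_mod_hom])

lemma lin_minus:
  "Module.module A X \<Longrightarrow> Module.module A Y \<Longrightarrow> f \<in> lin A X Y \<Longrightarrow> v \<in> carrier X \<Longrightarrow>
   w \<in> carrier X \<Longrightarrow> f (v \<ominus>\<^bsub>X\<^esub> w) = f v \<ominus>\<^bsub>Y\<^esub> f w"
  by (rule mod_hom.f_minus[OF lin_mod_hom])

lemma kernel_submodule:
  assumes "Module.module A X" "Module.module A Y" "f \<in> lin A X Y"
  shows "LinearCombinations.submodule A (a_kernel X Y f) X"
  using mod_hom.ker_is_submodule[OF lin_mod_hom[OF assms]]
  by (simp add: mod_hom.ker_def[OF lin_mod_hom[OF assms]] a_kernel_def')

lemma lin_zero_map:
  assumes "Module.module A Y" shows "(\<lambda>_. \<zero>\<^bsub>Y\<^esub>) \<in> lin A X Y"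
proof -
  interpret Y: Module.module A Y by fact
  show ?thesis by (rule linI) simp_all
qed

lemma lin_neg:
  "Module.module A X \<Longrightarrow> Module.module A Y \<Longrightarrow> f \<in> lin A X Y \<Longrightarrow> v \<in> carrier X \<Longrightarrow>
   f (\<ominus>\<^bsub>X\<^esub> v) = \<ominus>\<^bsub>Y\<^esub> f v"
  by (rule mod_hom.f_neg[OF lin_mod_hom])

lemma lin_diff:
  assumes "Module.module A X" "Module.module A Y" "f \<in> lin A X Y" "g \<in> lin A X Y"
  shows "(\<lambda>v. f v \<ominus>\<^bsub>Y\<^esub> g v) \<in> lin A X Y"
proof -
  interpret X: Module.module A X by fact
  interpret Y: Module.module A Y by fact
  note cl = lin_closed[OF assms(3)] lin_closed[OF assms(4)]
  show ?thesis
  proof (rule linI)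
    fix v assume "v \<in> carrier X"
    then show "f v \<ominus>\<^bsub>Y\<^esub> g v \<in> carrier Y" using cl by simp
  next
    fix v w assume vw: "v \<in> carrier X" "w \<in> carrier X"
    then have "f v \<in> carrier Y" "f w \<in> carrier Y" "g v \<in> carrier Y" "g w \<in> carrier Y"
      using cl by auto
    then show "f (v \<oplus>\<^bsub>X\<^esub> w) \<ominus>\<^bsub>Y\<^esub> g (v \<oplus>\<^bsub>X\<^esub> w) = f v \<ominus>\<^bsub>Y\<^esub> g v \<oplus>\<^bsub>Y\<^esub> (f w \<ominus>\<^bsub>Y\<^esub> g w)"
      using vw LinearCombinations.module_hom_add[OF assms(3)] LinearCombinations.module_hom_add[OF assms(4)]
      by (simp add: a_minus_def Y.minus_add Y.a_ac)
  next
    fix a v assume av: "a \<in> carrier A" "v \<in> carrier X"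
    then have "f v \<in> carrier Y" "g v \<in> carrier Y" using cl by auto
    then show "f (a \<odot>\<^bsub>X\<^esub> v) \<ominus>\<^bsub>Y\<^esub> g (a \<odot>\<^bsub>X\<^esub> v) = a \<odot>\<^bsub>Y\<^esub> (f v \<ominus>\<^bsub>Y\<^esub> g v)"
      using av LinearCombinations.module_hom_smult[OF assms(3)] LinearCombinations.module_hom_smult[OF assms(4)]
      by (simp add: a_minus_def Y.smult_r_distr Y.smult_r_minus)
  qed
qed

lemma lin_add:
  assumes "Module.module A X" "Module.module A Y" "f \<in> lin A X Y" "g \<in> lin A X Y"
  shows "(\<lambda>v. f v \<oplus>\<^bsub>Y\<^esub> g v) \<in> lin A X Y"
proof -
  interpret X: Module.module A X by fact
  interpret Y: Module.module A Y by fact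
  note cl = lin_closed[OF assms(3)] lin_closed[OF assms(4)]
  show ?thesis
  proof (rule linI)
    fix v assume "v \<in> carrier X"
    then show "f v \<oplus>\<^bsub>Y\<^esub> g v \<in> carrier Y" using cl by simp
  next
    fix v w assume vw: "v \<in> carrier X" "w \<in> carrier X"
    then have "f v \<in> carrier Y" "f w \<in> carrier Y" "g v \<in> carrier Y" "g w \<in> carrier Y"
      using cl by auto
    then show "f (v \<oplus>\<^bsub>X\<^esub> w) \<oplus>\<^bsub>Y\<^esub> g (v \<oplus>\<^bsub>X\<^esub> w) = f v \<oplus>\<^bsub>Y\<^esub> g v \<oplus>\<^bsub>Y\<^esub> (f w \<oplus>\<^bsub>Y\<^esub> g w)"
      using vw LinearCombinations.module_hom_add[OF assms(3)] LinearCombinations.module_hom_add[OF assms(4)]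
      by (simp add: Y.a_ac)
  next
    fix a v assume av: "a \<in> carrier A" "v \<in> carrier X"
    then have "f v \<in> carrier Y" "g v \<in> carrier Y" using cl by auto
    then show "f (a \<odot>\<^bsub>X\<^esub> v) \<oplus>\<^bsub>Y\<^esub> g (a \<odot>\<^bsub>X\<^esub> v) = a \<odot>\<^bsub>Y\<^esub> (f v \<oplus>\<^bsub>Y\<^esub> g v)"
      using av LinearCombinations.module_hom_smult[OF assms(3)] LinearCombinations.module_hom_smult[OF assms(4)]
      by (simp add: Y.smult_r_distr)
  qed
qed

lemma lin_uminus:
  assumes "Module.module A Y" "f \<in> lin A X Y"
  shows "(\<lambda>v. \<ominus>\<^bsub>Y\<^esub> f v) \<in> lin A X Y"
proof -
  interpret Y: Module.module A Y by fact
  note cl = lin_closed[OF assms(2)]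
  show ?thesis
    by (rule linI)
       (simp_all add: cl LinearCombinations.module_hom_add[OF assms(2)]
          LinearCombinations.module_hom_smult[OF assms(2)] Y.minus_add Y.smult_r_minus)
qed

context cring
begin

abbreviation fm :: "nat \<Rightarrow> ('a, nat \<Rightarrow> 'a) module"
  where "fm n \<equiv> free_module R n"

lemma fm_module: "Module.module R (fm n)"
  by (rule func_space_is_module)

lemma fm_carrier: "carrier (fm n) = {..<n} \<rightarrow>\<^sub>E carrier R"
  by (simp add: func_space_def)

lemma fm_memI:
  assumes "\<And>i. i < n \<Longrightarrow> v i \<in> carrier R" shows "restrict v {..<n} \<in> carrier (fm n)"
  using assms by (auto simp: fm_carrier)

lemma fm_coord: "v \<in> carrier (fm n) \<Longrightarrow> i < n \<Longrightarrow> v i \<in> carrier R"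
  by (auto simp: fm_carrier)

lemma fm_eqI:
  "v \<in> carrier (fm n) \<Longrightarrow> w \<in> carrier (fm n) \<Longrightarrow> (\<And>i. i < n \<Longrightarrow> v i = w i) \<Longrightarrow> v = w"
  unfolding fm_carrier by (rule PiE_ext) auto

lemma fm_add: "i < n \<Longrightarrow> (v \<oplus>\<^bsub>fm n\<^esub> w) i = v i \<oplus> w i"
  by (simp add: func_space_def)

lemma fm_smult: "i < n \<Longrightarrow> (a \<odot>\<^bsub>fm n\<^esub> v) i = a \<otimes> v i"
  by (simp add: func_space_def)

lemma fm_zero: "i < n \<Longrightarrow> \<zero>\<^bsub>fm n\<^esub> i = \<zero>"
  by (simp add: func_space_def)

lemma fm_neg: "v \<in> carrier (fm n) \<Longrightarrow> i < n \<Longrightarrow> (\<ominus>\<^bsub>fm n\<^esub> v) i = \<ominus> v i"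
  by (simp add: func_space_neg)

lemma fm_minus:
  "v \<in> carrier (fm n) \<Longrightarrow> w \<in> carrier (fm n) \<Longrightarrow> i < n \<Longrightarrow> (v \<ominus>\<^bsub>fm n\<^esub> w) i = v i \<ominus> w i"
  by (simp add: a_minus_def fm_add fm_neg)

lemmas fm_simps = fm_add fm_smult fm_zero fm_neg fm_minus

lemma fm_finsum:
  assumes "finite J" "\<And>j. j \<in> J \<Longrightarrow> g j \<in> carrier (fm n)" "i < n"
  shows "(\<Oplus>\<^bsub>fm n\<^esub> j\<in>J. g j) i = (\<Oplus>j\<in>J. g j i)"
  using assms(1,2)
proof (induction J rule: finite_induct)
  case empty
  interpret F: Module.module R "fm n" by (rule fm_module)
  show ?case using assms(3) by (simp add: fm_zero)
next
  case (insert k J)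
  interpret F: Module.module R "fm n" by (rule fm_module)
  have "(\<Oplus>\<^bsub>fm n\<^esub> j\<in>insert k J. g j) = g k \<oplus>\<^bsub>fm n\<^esub> (\<Oplus>\<^bsub>fm n\<^esub> j\<in>J. g j)"
    using insert by (intro F.finsum_insert) auto
  moreover have "(\<Oplus>j\<in>insert k J. g j i) = g k i \<oplus> (\<Oplus>j\<in>J. g j i)"
    using insert assms(3) by (intro finsum_insert) (auto intro: fm_coord)
  ultimately show ?case using insert assms(3) by (simp add: fm_add)
qed

definition unit_vec :: "nat \<Rightarrow> nat \<Rightarrow> nat \<Rightarrow> 'a"
  where "unit_vec n i = (\<lambda>j\<in>{..<n}. if i = j then \<one> else \<zero>)"

lemma unit_vec_closed: "unit_vec n i \<in> carrier (fm n)"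
  unfolding unit_vec_def by (rule fm_memI) auto

lemma fm_expand:
  assumes "v \<in> carrier (fm n)"
  shows "v = (\<Oplus>\<^bsub>fm n\<^esub> i\<in>{..<n}. v i \<odot>\<^bsub>fm n\<^esub> unit_vec n i)"
proof (rule fm_eqI[OF assms])
  interpret F: Module.module R "fm n" by (rule fm_module)
  have cl: "v i \<odot>\<^bsub>fm n\<^esub> unit_vec n i \<in> carrier (fm n)" if "i < n" for i
    using that assms by (intro F.smult_closed) (auto intro: fm_coord unit_vec_closed)
  then show "(\<Oplus>\<^bsub>fm n\<^esub> i\<in>{..<n}. v i \<odot>\<^bsub>fm n\<^esub> unit_vec n i) \<in> carrier (fm n)"
    by (intro F.finsum_closed) auto
  fix j assume j: "j < n"
  have "(\<Oplus>\<^bsub>fm n\<^esub> i\<in>{..<n}. v i \<odot>\<^bsub>fm n\<^esub> unit_vec n i) j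
      = (\<Oplus>i\<in>{..<n}. (v i \<odot>\<^bsub>fm n\<^esub> unit_vec n i) j)"
    using j cl by (intro fm_finsum) auto
  also have "\<dots> = (\<Oplus>i\<in>{..<n}. if j = i then v i else \<zero>)"
    using j assms fm_coord[OF assms] by (intro finsum_cong') (auto simp: fm_smult unit_vec_def fm_coord)
  also have "\<dots> = v j"
    using j assms by (subst finsum_singleton) (auto intro: fm_coord)
  finally show "v j = (\<Oplus>\<^bsub>fm n\<^esub> i\<in>{..<n}. v i \<odot>\<^bsub>fm n\<^esub> unit_vec n i) j" by simp
qed

lemma lin_expand:
  assumes "Module.module R X" "f \<in> lin R (fm n) X" "v \<in> carrier (fm n)"
  shows "f v = (\<Oplus>\<^bsub>X\<^esub> i\<in>{..<n}. v i \<odot>\<^bsub>X\<^esub> f (unit_vec n i))"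
proof -
  interpret X: Module.module R X by fact
  interpret f: mod_hom R "fm n" X f using lin_mod_hom[OF fm_module assms(1,2)] .
  let ?g = "\<lambda>i. v i \<odot>\<^bsub>fm n\<^esub> unit_vec n i"
  have cl: "?g \<in> {..<n} \<rightarrow> carrier (fm n)"
    using assms by (auto intro!: f.M.smult_closed intro: fm_coord unit_vec_closed)
  have "f (\<Oplus>\<^bsub>fm n\<^esub> i\<in>I. ?g i) = (\<Oplus>\<^bsub>X\<^esub> i\<in>I. f (?g i))" if "I \<subseteq> {..<n}" for I
    using finite_subset[OF that finite_lessThan] that
  proof (induction I rule: finite_induct)
    case (insert k I)
    then have g: "?g \<in> I \<rightarrow> carrier (fm n)" "?g k \<in> carrier (fm n)" using cl by auto
    show ?case using insert g by (simp add: Pi_iff)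
  qed simp
  from trans[OF arg_cong[OF fm_expand[OF assms(3)], of f] this[OF subset_refl]]
  have "f v = (\<Oplus>\<^bsub>X\<^esub> i\<in>{..<n}. f (?g i))" .
  also have "\<dots> = (\<Oplus>\<^bsub>X\<^esub> i\<in>{..<n}. v i \<odot>\<^bsub>X\<^esub> f (unit_vec n i))"
    using LinearCombinations.module_hom_smult[OF assms(2) fm_coord[OF assms(3)] unit_vec_closed]
      lin_closed[OF assms(2) unit_vec_closed] fm_coord[OF assms(3)]
    by (intro X.finsum_cong') auto
  finally show ?thesis .
qed

lemma lin_coord:
  assumes f: "f \<in> lin R (fm n) (fm k)" and v: "v \<in> carrier (fm n)" and i: "i < k"
  shows "f v i = (\<Oplus>j\<in>{..<n}. f (unit_vec n j) i \<otimes> v j)"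
proof -
  interpret F: Module.module R "fm k" by (rule fm_module)
  have ec: "f (unit_vec n j) \<in> carrier (fm k)" for j by (rule lin_closed[OF f unit_vec_closed])
  have "f v i = (\<Oplus>j\<in>{..<n}. (v j \<odot>\<^bsub>fm k\<^esub> f (unit_vec n j)) i)"
    unfolding lin_expand[OF fm_module f v]
    using i ec fm_coord[OF v] by (intro fm_finsum F.smult_closed) auto
  also have "\<dots> = (\<Oplus>j\<in>{..<n}. f (unit_vec n j) i \<otimes> v j)"
    using i fm_coord[OF v] fm_coord[OF ec i] by (intro finsum_cong') (auto simp: fm_smult m_comm)
  finally show ?thesis .
qed

lemma lin_from_basis:
  assumes "Module.module R X" "\<And>i. i < n \<Longrightarrow> x i \<in> carrier X"
  shows "(\<lambda>v. \<Oplus>\<^bsub>X\<^esub> i\<in>{..<n}. v i \<odot>\<^bsub>X\<^esub> x i) \<in> lin R (fm n) X" (is "?f \<in> _")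
proof -
  interpret X: Module.module R X by fact
  interpret F: Module.module R "fm n" by (rule fm_module)
  have sc: "v i \<odot>\<^bsub>X\<^esub> x i \<in> carrier X" if "v \<in> carrier (fm n)" "i < n" for v i
    using that assms(2) fm_coord by (intro X.smult_closed) auto
  show ?thesis
  proof (rule linI)
    fix v assume "v \<in> carrier (fm n)"
    then show "?f v \<in> carrier X" using sc by (intro X.finsum_closed) auto
  next
    fix v w assume vw: "v \<in> carrier (fm n)" "w \<in> carrier (fm n)"
    have "?f (v \<oplus>\<^bsub>fm n\<^esub> w) = (\<Oplus>\<^bsub>X\<^esub> i\<in>{..<n}. v i \<odot>\<^bsub>X\<^esub> x i \<oplus>\<^bsub>X\<^esub> w i \<odot>\<^bsub>X\<^esub> x i)"
      using vw sc assms(2) fm_coord[of v n] fm_coord[of w n]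
      by (intro X.finsum_cong') (auto simp: fm_add X.smult_l_distr)
    also have "\<dots> = ?f v \<oplus>\<^bsub>X\<^esub> ?f w"
      using vw sc by (intro X.finsum_addf) auto
    finally show "?f (v \<oplus>\<^bsub>fm n\<^esub> w) = ?f v \<oplus>\<^bsub>X\<^esub> ?f w" .
  next
    fix a v assume av: "a \<in> carrier R" "v \<in> carrier (fm n)"
    have "?f (a \<odot>\<^bsub>fm n\<^esub> v) = (\<Oplus>\<^bsub>X\<^esub> i\<in>{..<n}. a \<odot>\<^bsub>X\<^esub> (v i \<odot>\<^bsub>X\<^esub> x i))"
      using av sc assms(2) fm_coord[of v n]
      by (intro X.finsum_cong') (auto simp: fm_smult X.smult_assoc1)
    also have "\<dots> = a \<odot>\<^bsub>X\<^esub> ?f v"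
      using av sc by (intro X.finsum_smult_ldistr[symmetric]) auto
    finally show "?f (a \<odot>\<^bsub>fm n\<^esub> v) = a \<odot>\<^bsub>X\<^esub> ?f v" .
  qed
qed

lemma lin_coordwiseI:
  assumes X: "Module.module R X" and cl: "\<And>v. v \<in> carrier X \<Longrightarrow> f v \<in> carrier (fm n)"
    and add: "\<And>v w i. v \<in> carrier X \<Longrightarrow> w \<in> carrier X \<Longrightarrow> i < n \<Longrightarrow> f (v \<oplus>\<^bsub>X\<^esub> w) i = f v i \<oplus> f w i"
    and smult: "\<And>a v i. a \<in> carrier R \<Longrightarrow> v \<in> carrier X \<Longrightarrow> i < n \<Longrightarrow> f (a \<odot>\<^bsub>X\<^esub> v) i = a \<otimes> f v i"
  shows "f \<in> lin R X (fm n)"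
proof -
  interpret X: Module.module R X by fact
  interpret F: Module.module R "fm n" by (rule fm_module)
  show ?thesis
  proof (rule linI)
    show "f v \<in> carrier (fm n)" if "v \<in> carrier X" for v by (rule cl[OF that])
    show "f (v \<oplus>\<^bsub>X\<^esub> w) = f v \<oplus>\<^bsub>fm n\<^esub> f w" if "v \<in> carrier X" "w \<in> carrier X" for v w
      by (rule fm_eqI[where n = n]) (simp_all add: that cl add fm_add)
    show "f (a \<odot>\<^bsub>X\<^esub> v) = a \<odot>\<^bsub>fm n\<^esub> f v" if "a \<in> carrier R" "v \<in> carrier X" for a v
      by (rule fm_eqI[where n = n]) (simp_all add: that cl smult fm_smult)
  qed
qed

lemma lin_from_basis_unit:
  assumes "Module.module R X" "\<And>i. i < n \<Longrightarrow> x i \<in> carrier X" "j < n"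
  shows "(\<Oplus>\<^bsub>X\<^esub> i\<in>{..<n}. unit_vec n j i \<odot>\<^bsub>X\<^esub> x i) = x j"
proof -
  interpret X: Module.module R X by fact
  have "(\<Oplus>\<^bsub>X\<^esub> i\<in>{..<n}. unit_vec n j i \<odot>\<^bsub>X\<^esub> x i)
      = (\<Oplus>\<^bsub>X\<^esub> i\<in>{..<n}. if j = i then x i else \<zero>\<^bsub>X\<^esub>)"
    using assms(2) by (intro X.finsum_cong') (auto simp: unit_vec_def)
  then show ?thesis using assms(2,3) by (simp add: X.finsum_singleton)
qed

text \<open>
  Free modules are projective: preimages of the images of the basis vectors can be chosen freely.
  All maps between resolutions come from this.
\<close>

lemma lin_lift:
  assumes X: "Module.module R X" and Y: "Module.module R Y"
    and g: "g \<in> lin R X Y" and f: "f \<in> lin R (fm n) Y"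
    and sub: "\<And>v. v \<in> carrier (fm n) \<Longrightarrow> f v \<in> g ` carrier X"
  shows "\<exists>h \<in> lin R (fm n) X. \<forall>v \<in> carrier (fm n). g (h v) = f v"
proof -
  interpret X: Module.module R X by fact
  have "\<exists>x. x \<in> carrier X \<and> g x = f (unit_vec n i)" for i
    using sub[OF unit_vec_closed, of i] by auto
  then have "\<forall>i. \<exists>x. x \<in> carrier X \<and> g x = f (unit_vec n i)" by blast
  from choice[OF this] obtain x
    where x: "\<And>i. x i \<in> carrier X" "\<And>i. g (x i) = f (unit_vec n i)" by blast
  let ?h = "\<lambda>v. \<Oplus>\<^bsub>X\<^esub> i\<in>{..<n}. v i \<odot>\<^bsub>X\<^esub> x i"
  have h: "?h \<in> lin R (fm n) X" by (rule lin_from_basis[OF X x(1)])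
  have hx: "?h (unit_vec n j) = x j" if "j < n" for j
    by (rule lin_from_basis_unit[OF X x(1) that])
  have "g (?h v) = f v" if v: "v \<in> carrier (fm n)" for v
  proof -
    interpret Y: Module.module R Y by fact
    have "g (?h v) = (\<Oplus>\<^bsub>Y\<^esub> i\<in>{..<n}. v i \<odot>\<^bsub>Y\<^esub> g (?h (unit_vec n i)))"
      using lin_expand[OF Y lin_comp[OF h g] v] .
    also have "\<dots> = (\<Oplus>\<^bsub>Y\<^esub> i\<in>{..<n}. v i \<odot>\<^bsub>Y\<^esub> f (unit_vec n i))"
      using hx x(2) v fm_coord[of v n] lin_closed[OF f unit_vec_closed]
      by (intro Y.finsum_cong') auto
    also have "\<dots> = f v" using lin_expand[OF Y f v] by simp
    finally show ?thesis .
  qed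
  then show ?thesis by (intro bexI[OF _ h] ballI)
qed

end

section \<open>Vectors with coordinates in an ideal\<close>

context cring
begin

definition fm_ideal :: "'a set \<Rightarrow> nat \<Rightarrow> (nat \<Rightarrow> 'a) set"
  where "fm_ideal I n = {v \<in> carrier (fm n). \<forall>i<n. v i \<in> I}"

lemma fm_ideal_carrier: "v \<in> fm_ideal I n \<Longrightarrow> v \<in> carrier (fm n)"
  by (simp add: fm_ideal_def)

lemma finsum_in_ideal:
  assumes I: "ideal I R" and "\<And>j. j \<in> J \<Longrightarrow> g j \<in> I"
  shows "(\<Oplus>j\<in>J. g j) \<in> I"
  using assms(2)
proof (induction J rule: infinite_finite_induct)
  case (insert k J)
  have "g ` insert k J \<subseteq> carrier R" using insert.prems ideal.Icarr[OF I] by auto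
  then show ?case
    using insert additive_subgroup.a_closed[OF ideal.axioms(1)[OF I]] by (simp add: image_subset_iff Pi_iff)
qed (simp_all add: additive_subgroup.zero_closed[OF ideal.axioms(1)[OF I]])

lemma fm_ideal_add:
  assumes I: "ideal I R" and "v \<in> fm_ideal I n" "w \<in> fm_ideal I n"
  shows "v \<oplus>\<^bsub>fm n\<^esub> w \<in> fm_ideal I n"
proof -
  interpret F: Module.module R "fm n" by (rule fm_module)
  show ?thesis
    using assms additive_subgroup.a_closed[OF ideal.axioms(1)[OF I]]
    by (auto simp: fm_ideal_def fm_add)
qed

lemma fm_ideal_minus:
  assumes I: "ideal I R" and "v \<in> fm_ideal I n" "w \<in> fm_ideal I n"
  shows "v \<ominus>\<^bsub>fm n\<^esub> w \<in> fm_ideal I n"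
proof -
  interpret F: Module.module R "fm n" by (rule fm_module)
  show ?thesis
    using assms additive_subgroup.a_closed[OF ideal.axioms(1)[OF I]]
      additive_subgroup.a_inv_closed[OF ideal.axioms(1)[OF I]]
    by (auto simp: fm_ideal_def fm_minus a_minus_def fm_add fm_neg)
qed

lemma fm_ideal_minus_cancel:
  assumes I: "ideal I R"
    and "v \<in> carrier (fm n)" "w \<in> fm_ideal I n" "v \<ominus>\<^bsub>fm n\<^esub> w \<in> fm_ideal I n"
  shows "v \<in> fm_ideal I n"
proof -
  interpret F: Module.module R "fm n" by (rule fm_module)
  have "v = (v \<ominus>\<^bsub>fm n\<^esub> w) \<oplus>\<^bsub>fm n\<^esub> w"
    using assms(2) fm_ideal_carrier[OF assms(3)] by (simp add: a_minus_def F.a_assoc F.l_neg)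
  then show ?thesis using fm_ideal_add[OF I assms(4,3)] by simp
qed

lemma lin_fm_ideal:
  assumes I: "ideal I R" and f: "f \<in> lin R (fm n) (fm k)" and v: "v \<in> fm_ideal I n"
  shows "f v \<in> fm_ideal I k"
proof -
  have vc: "v \<in> carrier (fm n)" using v by (rule fm_ideal_carrier)
  have "f v i \<in> I" if i: "i < k" for i
    unfolding lin_coord[OF f vc i]
    using v fm_coord[OF lin_closed[OF f unit_vec_closed] i]
    by (intro finsum_in_ideal[OF I]) (auto simp: fm_ideal_def intro: ideal.I_l_closed[OF I])
  then show ?thesis using lin_closed[OF f vc] by (simp add: fm_ideal_def)
qed

text \<open>
  Gaussian elimination over the residue field \<open>R/I\<close>, carried out with representatives in \<open>R\<close>
  and by induction on the equations \<open>E\<close>. If the coefficients of the new equation all lie in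
  \<open>I\<close>, it holds for every vector. Otherwise one of them is a unit, and solving for its unknown
  removes one equation and one unknown.
\<close>

lemma linear_system_mod_ideal:
  assumes I: "ideal I R" and one: "\<one> \<notin> I"
    and unit: "\<And>a. a \<in> carrier R \<Longrightarrow> a \<notin> I \<Longrightarrow> a \<in> Units R"
    and "finite E" "finite J" "card E < card J"
    and "\<And>i j. i \<in> E \<Longrightarrow> j \<in> J \<Longrightarrow> a i j \<in> carrier R"
  shows "\<exists>v. (\<forall>j\<in>J. v j \<in> carrier R) \<and> (\<exists>j\<in>J. v j \<notin> I) \<and> (\<forall>i\<in>E. (\<Oplus>j\<in>J. a i j \<otimes> v j) \<in> I)"
  using assms(4-)
proof (induction E arbitrary: J a rule: finite_induct)
  case empty
  then obtain j where "j \<in> J" by fastforce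
  then show ?case using one by (intro exI[of _ "\<lambda>_. \<one>"]) auto
next
  case (insert k E)
  note Isub = ideal.Icarr[OF I]
  note Iad = ideal.axioms(1)[OF I]
  have a: "a i j \<in> carrier R" if "i \<in> insert k E" "j \<in> J" for i j using insert.prems that by blast
  show ?case
  proof (cases "\<forall>j\<in>J. a k j \<in> I")
    case True
    have "card E < card J" using insert by simp
    with insert.IH[of J a] insert.prems a obtain v where v: "\<forall>j\<in>J. v j \<in> carrier R"
      "\<exists>j\<in>J. v j \<notin> I" "\<forall>i\<in>E. (\<Oplus>j\<in>J. a i j \<otimes> v j) \<in> I" by auto
    have "(\<Oplus>j\<in>J. a k j \<otimes> v j) \<in> I"
      using True v(1) by (intro finsum_in_ideal[OF I] ideal.I_r_closed[OF I]) auto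
    then show ?thesis using v by (intro exI[of _ v]) auto
  next
    case False
    then obtain p where p: "p \<in> J" "a k p \<notin> I" by blast
    then have "a k p \<in> Units R" using unit a by simp
    \<comment> \<open>Equation \<open>k\<close> is solved for the unknown \<open>p\<close>.\<close>
    define t where "t = inv (a k p)"
    have t: "t \<in> carrier R" "a k p \<otimes> t = \<one>"
      using \<open>a k p \<in> Units R\<close> by (auto simp: t_def)
    define J' where "J' = J - {p}"
    have J': "finite J'" "p \<notin> J'" "J = insert p J'" "card E < card J'"
      using insert p by (auto simp: J'_def)
    have ac: "a i j \<in> carrier R" "a i p \<in> carrier R" "a k j \<in> carrier R" "a k p \<in> carrier R"
      if "i \<in> E" "j \<in> J'" for i j using a that J' by auto
    have akc: "a k j \<in> carrier R" "a k p \<in> carrier R" if "j \<in> J'" for j using a that J' by auto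
    \<comment> \<open>The remaining equations after subtracting multiples of equation \<open>k\<close> that clear column \<open>p\<close>.\<close>
    define a' where "a' i j = a i j \<ominus> (a i p \<otimes> t) \<otimes> a k j" for i j
    have "a' i j \<in> carrier R" if "i \<in> E" "j \<in> J'" for i j
      using ac[OF that] t by (simp add: a'_def)
    with insert.IH[of J' a'] J' obtain v where v: "\<forall>j\<in>J'. v j \<in> carrier R"
      "\<exists>j\<in>J'. v j \<notin> I" "\<forall>i\<in>E. (\<Oplus>j\<in>J'. a' i j \<otimes> v j) \<in> I" by auto
    define s where "s = (\<Oplus>j\<in>J'. a k j \<otimes> v j)"
    have s: "s \<in> carrier R" using v(1) akc unfolding s_def by (intro finsum_closed) auto
    define w where "w = v(p := \<ominus> (t \<otimes> s))"
    have wp: "w p = \<ominus> (t \<otimes> s)" and wv: "\<And>j. j \<in> J' \<Longrightarrow> w j = v j" using J' by (auto simp: w_def)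
    have split: "(\<Oplus>j\<in>J. a i j \<otimes> w j) = a i p \<otimes> (\<ominus> (t \<otimes> s)) \<oplus> (\<Oplus>j\<in>J'. a i j \<otimes> v j)"
      if i: "i \<in> insert k E" for i
    proof -
      have "(\<Oplus>j\<in>J. a i j \<otimes> w j) = a i p \<otimes> w p \<oplus> (\<Oplus>j\<in>J'. a i j \<otimes> w j)"
        unfolding J'(3) using J' v(1) a i t s by (intro finsum_insert) (auto simp: wp wv)
      also have "(\<Oplus>j\<in>J'. a i j \<otimes> w j) = (\<Oplus>j\<in>J'. a i j \<otimes> v j)"
        using J' v(1) a i by (intro finsum_cong') (auto simp: wv)
      finally show ?thesis by (simp add: wp)
    qed
    have "(\<Oplus>j\<in>J. a k j \<otimes> w j) = \<zero>"
    proof -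
      have "a k p \<otimes> (\<ominus> (t \<otimes> s)) = \<ominus> ((a k p \<otimes> t) \<otimes> s)"
        using t(1) s a[of k p] p by (simp add: r_minus m_assoc)
      then have "a k p \<otimes> (\<ominus> (t \<otimes> s)) = \<ominus> s" using t s by simp
      then show ?thesis using s by (simp add: split s_def[symmetric] l_neg)
    qed
    moreover have "(\<Oplus>j\<in>J. a i j \<otimes> w j) \<in> I" if i: "i \<in> E" for i
    proof -
      have ip: "a i p \<in> carrier R" using a i p by simp
      let ?c = "\<ominus> (a i p \<otimes> t)"
      have c: "?c \<in> carrier R" using ip t by simp
      have "(\<Oplus>j\<in>J'. a' i j \<otimes> v j) = (\<Oplus>j\<in>J'. a i j \<otimes> v j \<oplus> ?c \<otimes> (a k j \<otimes> v j))"
        using v(1) ac[OF i] akc t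
        by (intro finsum_cong')
           (auto simp: a'_def a_minus_def l_distr l_minus m_assoc)
      also have "\<dots> = (\<Oplus>j\<in>J'. a i j \<otimes> v j) \<oplus> (\<Oplus>j\<in>J'. ?c \<otimes> (a k j \<otimes> v j))"
        using v(1) ac[OF i] akc c by (intro finsum_addf) auto
      also have "(\<Oplus>j\<in>J'. ?c \<otimes> (a k j \<otimes> v j)) = ?c \<otimes> s"
        unfolding s_def using J' v(1) akc c by (intro finsum_rdistr[symmetric]) auto
      also have "?c \<otimes> s = a i p \<otimes> (\<ominus> (t \<otimes> s))"
        using ip t s by (simp add: l_minus r_minus m_assoc)
      also have "(\<Oplus>j\<in>J'. a i j \<otimes> v j) \<oplus> a i p \<otimes> (\<ominus> (t \<otimes> s)) = (\<Oplus>j\<in>J. a i j \<otimes> w j)"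
      proof -
        have "(\<Oplus>j\<in>J'. a i j \<otimes> v j) \<in> carrier R" using v(1) ac[OF i] by (intro finsum_closed) auto
        then show ?thesis using ip t s i by (subst split) (auto simp: a_comm)
      qed
      finally show ?thesis using bspec[OF v(3) i] by metis
    qed
    ultimately have "\<forall>i\<in>insert k E. (\<Oplus>j\<in>J. a i j \<otimes> w j) \<in> I"
      using additive_subgroup.zero_closed[OF Iad] by auto
    moreover have "\<forall>j\<in>J. w j \<in> carrier R" using v(1) s t J' wp wv by auto
    moreover have "\<exists>j\<in>J. w j \<notin> I" using v(2) J' wv by auto
    ultimately show ?thesis by blast
  qed
qed

end

section \<open>Comparison of free resolutions\<close>

lemma minimal_is_resolution: "minimal_free_resolution A X b d \<epsilon> \<Longrightarrow> free_resolution A X b d \<epsilon>"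
  by (simp add: minimal_free_resolution_def)

lemma (in abelian_group) minus_minus_cancel:
  assumes "v \<in> carrier G" "b \<in> carrier G"
  shows "v \<ominus> (v \<ominus> b) = b"
  using assms by (simp add: a_minus_def minus_add minus_minus a_assoc[symmetric] r_neg)

context cring
begin

lemma resolution_aug: "free_resolution R M b d \<epsilon> \<Longrightarrow> \<epsilon> \<in> lin R (fm (b 0)) M"
  by (simp add: free_resolution_def)

lemma resolution_diff: "free_resolution R M b d \<epsilon> \<Longrightarrow> d n \<in> lin R (fm (b (Suc n))) (fm (b n))"
  by (simp add: free_resolution_def)

lemma resolution_aug_onto: "free_resolution R M b d \<epsilon> \<Longrightarrow> \<epsilon> ` carrier (fm (b 0)) = carrier M"
  by (simp add: free_resolution_def)

lemma resolution_exact_0: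
  "free_resolution R M b d \<epsilon> \<Longrightarrow>
   v \<in> d 0 ` carrier (fm (b (Suc 0))) \<longleftrightarrow> v \<in> carrier (fm (b 0)) \<and> \<epsilon> v = \<zero>\<^bsub>M\<^esub>"
  by (simp add: free_resolution_def a_kernel_def')

lemma resolution_exact_Suc:
  "free_resolution R M b d \<epsilon> \<Longrightarrow>
   v \<in> d (Suc n) ` carrier (fm (b (Suc (Suc n)))) \<longleftrightarrow>
   v \<in> carrier (fm (b (Suc n))) \<and> d n v = \<zero>\<^bsub>fm (b n)\<^esub>"
  by (simp add: free_resolution_def a_kernel_def')

lemma resolution_comp_Suc:
  "free_resolution R M b d \<epsilon> \<Longrightarrow> v \<in> carrier (fm (b (Suc (Suc n)))) \<Longrightarrow>
   d n (d (Suc n) v) = \<zero>\<^bsub>fm (b n)\<^esub>"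
  using resolution_exact_Suc[of M b d \<epsilon> "d (Suc n) v" n] by blast

lemma resolution_comp_0:
  "free_resolution R M b d \<epsilon> \<Longrightarrow> v \<in> carrier (fm (b (Suc 0))) \<Longrightarrow> \<epsilon> (d 0 v) = \<zero>\<^bsub>M\<^esub>"
  using resolution_exact_0[of M b d \<epsilon> "d 0 v"] by blast

text \<open>
  Comparison theorem. The linear map to be lifted enters only through its composite \<open>\<phi>\<close> with
  the augmentation; the hypothesis on kernels says that \<open>\<phi>\<close> comes from a map on \<open>X\<close>.
\<close>

lemma chain_map_exists:
  assumes X: "free_resolution R X c dC \<epsilon>C" and Y: "free_resolution R Y b dB \<epsilon>B"
    and Ymod: "Module.module R Y"
    and \<phi>: "\<phi> \<in> lin R (fm (c 0)) Y"
    and ker: "\<And>v. v \<in> carrier (fm (c 0)) \<Longrightarrow> \<epsilon>C v = \<zero>\<^bsub>X\<^esub> \<Longrightarrow> \<phi> v = \<zero>\<^bsub>Y\<^esub>"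
  shows "\<exists>\<alpha>. (\<forall>n. \<alpha> n \<in> lin R (fm (c n)) (fm (b n))) \<and>
             (\<forall>v \<in> carrier (fm (c 0)). \<epsilon>B (\<alpha> 0 v) = \<phi> v) \<and>
             (\<forall>n. \<forall>v \<in> carrier (fm (c (Suc n))). dB n (\<alpha> (Suc n) v) = \<alpha> n (dC n v))"
proof -
  note C = resolution_diff[OF X] and B = resolution_diff[OF Y]
  \<comment> \<open>Mapping boundaries to boundaries is what the next lift needs, and it is a condition on
     a single map, whereas commuting with the differentials involves two consecutive ones.\<close>
  define P where "P n a \<longleftrightarrow> a \<in> lin R (fm (c n)) (fm (b n)) \<and>
      (n = 0 \<longrightarrow> (\<forall>v \<in> carrier (fm (c 0)). \<epsilon>B (a v) = \<phi> v)) \<and>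
      (\<forall>v \<in> carrier (fm (c (Suc n))). a (dC n v) \<in> dB n ` carrier (fm (b (Suc n))))" for n a
  define Q where "Q n a a' \<longleftrightarrow> (\<forall>v \<in> carrier (fm (c (Suc n))). dB n (a' v) = a (dC n v))"
    for n and a a' :: "(nat \<Rightarrow> 'a) \<Rightarrow> (nat \<Rightarrow> 'a)"
  have "\<exists>a. P 0 a"
  proof -
    have "\<phi> v \<in> \<epsilon>B ` carrier (fm (b 0))" if "v \<in> carrier (fm (c 0))" for v
      using lin_closed[OF \<phi> that] resolution_aug_onto[OF Y] by simp
    from lin_lift[OF fm_module Ymod resolution_aug[OF Y] \<phi> this]
    obtain a where a: "a \<in> lin R (fm (c 0)) (fm (b 0))"
      "\<And>v. v \<in> carrier (fm (c 0)) \<Longrightarrow> \<epsilon>B (a v) = \<phi> v" by blast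
    have "a (dC 0 v) \<in> dB 0 ` carrier (fm (b (Suc 0)))" if v: "v \<in> carrier (fm (c (Suc 0)))" for v
      unfolding resolution_exact_0[OF Y]
      using lin_closed[OF C v] a(2) lin_closed[OF a(1)] ker resolution_comp_0[OF X v] by simp
    then show ?thesis using a unfolding P_def by blast
  qed
  moreover have "\<exists>a'. P (Suc n) a' \<and> Q n a a'" if "P n a" for n a
  proof -
    have a: "a \<in> lin R (fm (c n)) (fm (b n))"
      and im: "\<And>v. v \<in> carrier (fm (c (Suc n))) \<Longrightarrow> a (dC n v) \<in> dB n ` carrier (fm (b (Suc n)))"
      using that by (auto simp: P_def)
    from lin_lift[OF fm_module fm_module B lin_comp[OF C a] im]
    obtain a' where a': "a' \<in> lin R (fm (c (Suc n))) (fm (b (Suc n)))"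
      "\<And>v. v \<in> carrier (fm (c (Suc n))) \<Longrightarrow> dB n (a' v) = a (dC n v)" by blast
    have "a' (dC (Suc n) v) \<in> dB (Suc n) ` carrier (fm (b (Suc (Suc n))))"
      if v: "v \<in> carrier (fm (c (Suc (Suc n))))" for v
      unfolding resolution_exact_Suc[OF Y]
      using lin_closed[OF C v] a'(2) lin_closed[OF a'(1)] resolution_comp_Suc[OF X v]
        lin_zero[OF fm_module fm_module a] by simp
    then show ?thesis using a' unfolding P_def Q_def by blast
  qed
  ultimately obtain \<alpha> where PQ: "\<And>n. P n (\<alpha> n) \<and> Q n (\<alpha> n) (\<alpha> (Suc n))"
    using dependent_nat_choice[of P Q] by metis
  have "\<alpha> n \<in> lin R (fm (c n)) (fm (b n))" for n
    using PQ[of n] by (simp add: P_def)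
  moreover have "\<epsilon>B (\<alpha> 0 v) = \<phi> v" if "v \<in> carrier (fm (c 0))" for v
    using PQ[of 0] that by (simp add: P_def)
  moreover have "dB n (\<alpha> (Suc n) v) = \<alpha> n (dC n v)" if "v \<in> carrier (fm (c (Suc n)))" for n v
    using PQ[of n] that by (simp add: Q_def)
  ultimately show ?thesis by (intro exI[of _ \<alpha>] conjI allI ballI)
qed

text \<open>
  The homotopy in degree \<open>n + 1\<close> lifts \<open>\<gamma> - h d\<close> through the differential, which is possible
  because \<open>d h = \<gamma>\<close> on boundaries.
\<close>

lemma null_homotopy_exists:
  assumes X: "free_resolution R X c d \<epsilon>" and Xmod: "Module.module R X"
    and \<gamma>: "\<And>n. \<gamma> n \<in> lin R (fm (c n)) (fm (c n))"
    and \<gamma>0: "\<And>v. v \<in> carrier (fm (c 0)) \<Longrightarrow> \<epsilon> (\<gamma> 0 v) = \<zero>\<^bsub>X\<^esub>"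
    and \<gamma>d: "\<And>n v. v \<in> carrier (fm (c (Suc n))) \<Longrightarrow> d n (\<gamma> (Suc n) v) = \<gamma> n (d n v)"
  shows "\<exists>h. (\<forall>n. h n \<in> lin R (fm (c n)) (fm (c (Suc n)))) \<and>
             (\<forall>v \<in> carrier (fm (c 0)). d 0 (h 0 v) = \<gamma> 0 v) \<and>
             (\<forall>n. \<forall>v \<in> carrier (fm (c (Suc n))).
                d (Suc n) (h (Suc n) v) = \<gamma> (Suc n) v \<ominus>\<^bsub>fm (c (Suc n))\<^esub> h n (d n v))"
proof -
  note D = resolution_diff[OF X]
  define P where "P n h \<longleftrightarrow> h \<in> lin R (fm (c n)) (fm (c (Suc n))) \<and>
      (n = 0 \<longrightarrow> (\<forall>v \<in> carrier (fm (c 0)). d 0 (h v) = \<gamma> 0 v)) \<and>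
      (\<forall>v \<in> carrier (fm (c (Suc n))). d n (h (d n v)) = \<gamma> n (d n v))" for n h
  define Q where "Q n h h' \<longleftrightarrow> (\<forall>v \<in> carrier (fm (c (Suc n))).
      d (Suc n) (h' v) = \<gamma> (Suc n) v \<ominus>\<^bsub>fm (c (Suc n))\<^esub> h (d n v))"
    for n and h h' :: "(nat \<Rightarrow> 'a) \<Rightarrow> (nat \<Rightarrow> 'a)"
  have "\<exists>h. P 0 h"
  proof -
    have "\<gamma> 0 v \<in> d 0 ` carrier (fm (c (Suc 0)))" if "v \<in> carrier (fm (c 0))" for v
      unfolding resolution_exact_0[OF X] using lin_closed[OF \<gamma> that] \<gamma>0[OF that] by simp
    from lin_lift[OF fm_module fm_module D \<gamma> this]
    obtain h where h: "h \<in> lin R (fm (c 0)) (fm (c (Suc 0)))"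
      "\<And>v. v \<in> carrier (fm (c 0)) \<Longrightarrow> d 0 (h v) = \<gamma> 0 v" by blast
    then show ?thesis unfolding P_def using lin_closed[OF D[of 0]] by blast
  qed
  moreover have "\<exists>h'. P (Suc n) h' \<and> Q n h h'" if "P n h" for n h
  proof -
    interpret F: Module.module R "fm (c n)" by (rule fm_module)
    interpret G: Module.module R "fm (c (Suc n))" by (rule fm_module)
    have h: "h \<in> lin R (fm (c n)) (fm (c (Suc n)))"
      and hd: "\<And>v. v \<in> carrier (fm (c (Suc n))) \<Longrightarrow> d n (h (d n v)) = \<gamma> n (d n v)"
      using that by (auto simp: P_def)
    let ?f = "\<lambda>v. \<gamma> (Suc n) v \<ominus>\<^bsub>fm (c (Suc n))\<^esub> h (d n v)"
    have f: "?f \<in> lin R (fm (c (Suc n))) (fm (c (Suc n)))"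
      by (rule lin_diff[OF fm_module fm_module \<gamma> lin_comp[OF D h]])
    have "?f v \<in> d (Suc n) ` carrier (fm (c (Suc (Suc n))))"
      if v: "v \<in> carrier (fm (c (Suc n)))" for v
    proof -
      have "d n (?f v) = d n (\<gamma> (Suc n) v) \<ominus>\<^bsub>fm (c n)\<^esub> d n (h (d n v))"
        by (rule lin_minus[OF fm_module fm_module D lin_closed[OF \<gamma> v] lin_closed[OF h lin_closed[OF D v]]])
      also have "\<dots> = \<zero>\<^bsub>fm (c n)\<^esub>"
        using hd[OF v] \<gamma>d[OF v] lin_closed[OF \<gamma> lin_closed[OF D v]] by simp
      finally show ?thesis unfolding resolution_exact_Suc[OF X] using lin_closed[OF f v] by simp
    qed
    from lin_lift[OF fm_module fm_module D f this]
    obtain h' where h': "h' \<in> lin R (fm (c (Suc n))) (fm (c (Suc (Suc n))))"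
      "\<And>v. v \<in> carrier (fm (c (Suc n))) \<Longrightarrow> d (Suc n) (h' v) = ?f v" by blast
    have "d (Suc n) (h' (d (Suc n) v)) = \<gamma> (Suc n) (d (Suc n) v)"
      if v: "v \<in> carrier (fm (c (Suc (Suc n))))" for v
    proof -
      have "\<gamma> (Suc n) (d (Suc n) v) \<in> carrier (fm (c (Suc n)))"
        by (rule lin_closed[OF \<gamma> lin_closed[OF D v]])
      then show ?thesis
        using h'(2)[OF lin_closed[OF D v]] resolution_comp_Suc[OF X v]
          lin_zero[OF fm_module fm_module h] by (simp add: a_minus_def)
    qed
    then show ?thesis using h' unfolding P_def Q_def by blast
  qed
  ultimately obtain h where PQ: "\<And>n. P n (h n) \<and> Q n (h n) (h (Suc n))"
    using dependent_nat_choice[of P Q] by metis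
  have "h n \<in> lin R (fm (c n)) (fm (c (Suc n)))" for n
    using PQ[of n] by (simp add: P_def)
  moreover have "d 0 (h 0 v) = \<gamma> 0 v" if "v \<in> carrier (fm (c 0))" for v
    using PQ[of 0] that by (simp add: P_def)
  moreover have "d (Suc n) (h (Suc n) v) = \<gamma> (Suc n) v \<ominus>\<^bsub>fm (c (Suc n))\<^esub> h n (d n v)"
    if "v \<in> carrier (fm (c (Suc n)))" for n v
    using PQ[of n] that by (simp add: Q_def)
  ultimately show ?thesis by (intro exI[of _ h] conjI allI ballI)
qed

text \<open>
  With comparison maps \<open>\<alpha>\<close>, \<open>\<beta>\<close> in both directions, \<open>id - \<beta>\<alpha> = d h + h d\<close> for some
  homotopy \<open>h\<close>. Thus \<open>v - d h v = \<beta> \<alpha> v + h d v\<close>, and linear maps preserve the vectors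
  with coordinates in \<open>I\<close>. In other words, \<open>\<alpha>\<close> is injective on the homology of the complexes
  modulo \<open>I\<close>; a vector in degree \<open>0\<close> counts as a cycle without further condition.
\<close>

lemma tor_injective:
  assumes X: "free_resolution R X c dC \<epsilon>C" and Y: "free_resolution R X b dB \<epsilon>B"
    and Xmod: "Module.module R X" and I: "ideal I R"
  obtains \<alpha> where "\<And>n. \<alpha> n \<in> lin R (fm (c n)) (fm (b n))"
    and "\<And>n v. v \<in> carrier (fm (c n)) \<Longrightarrow> \<alpha> n v \<in> fm_ideal I (b n) \<Longrightarrow>
      (\<forall>m. n = Suc m \<longrightarrow> dC m v \<in> fm_ideal I (c m)) \<Longrightarrow>
      \<exists>w \<in> carrier (fm (c (Suc n))). v \<ominus>\<^bsub>fm (c n)\<^esub> dC n w \<in> fm_ideal I (c n)"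
proof -
  note C = resolution_diff[OF X] and B = resolution_diff[OF Y]
  from chain_map_exists[OF X Y Xmod resolution_aug[OF X]]
  obtain \<alpha> where \<alpha>: "\<And>n. \<alpha> n \<in> lin R (fm (c n)) (fm (b n))"
    "\<And>v. v \<in> carrier (fm (c 0)) \<Longrightarrow> \<epsilon>B (\<alpha> 0 v) = \<epsilon>C v"
    "\<And>n v. v \<in> carrier (fm (c (Suc n))) \<Longrightarrow> dB n (\<alpha> (Suc n) v) = \<alpha> n (dC n v)" by blast
  from chain_map_exists[OF Y X Xmod resolution_aug[OF Y]]
  obtain \<beta> where \<beta>: "\<And>n. \<beta> n \<in> lin R (fm (b n)) (fm (c n))"
    "\<And>v. v \<in> carrier (fm (b 0)) \<Longrightarrow> \<epsilon>C (\<beta> 0 v) = \<epsilon>B v"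
    "\<And>n v. v \<in> carrier (fm (b (Suc n))) \<Longrightarrow> dC n (\<beta> (Suc n) v) = \<beta> n (dB n v)" by blast
  define \<gamma> where "\<gamma> n = (\<lambda>v. v \<ominus>\<^bsub>fm (c n)\<^esub> \<beta> n (\<alpha> n v))" for n
  note \<beta>\<alpha> = lin_comp[OF \<alpha>(1) \<beta>(1)]
  have id: "(\<lambda>v. v) \<in> lin R (fm (c n)) (fm (c n))" for n by (rule linI) simp_all
  have \<gamma>: "\<gamma> n \<in> lin R (fm (c n)) (fm (c n))" for n
    unfolding \<gamma>_def by (rule lin_diff[OF fm_module fm_module id \<beta>\<alpha>])
  have \<gamma>0: "\<epsilon>C (\<gamma> 0 v) = \<zero>\<^bsub>X\<^esub>" if v: "v \<in> carrier (fm (c 0))" for v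
  proof -
    interpret M: Module.module R X by (rule Xmod)
    have "\<epsilon>C (\<gamma> 0 v) = \<epsilon>C v \<ominus>\<^bsub>X\<^esub> \<epsilon>C (\<beta> 0 (\<alpha> 0 v))"
      unfolding \<gamma>_def by (rule lin_minus[OF fm_module Xmod resolution_aug[OF X] v lin_closed[OF \<beta>\<alpha> v]])
    then show ?thesis
      using \<beta>(2)[OF lin_closed[OF \<alpha>(1) v]] \<alpha>(2)[OF v] lin_closed[OF resolution_aug[OF X] v] by simp
  qed
  have \<gamma>d: "dC n (\<gamma> (Suc n) v) = \<gamma> n (dC n v)" if v: "v \<in> carrier (fm (c (Suc n)))" for n v
  proof -
    have "dC n (\<gamma> (Suc n) v) = dC n v \<ominus>\<^bsub>fm (c n)\<^esub> dC n (\<beta> (Suc n) (\<alpha> (Suc n) v))"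
      unfolding \<gamma>_def by (rule lin_minus[OF fm_module fm_module C v lin_closed[OF \<beta>\<alpha> v]])
    then show ?thesis
      using \<beta>(3)[OF lin_closed[OF \<alpha>(1) v]] \<alpha>(3)[OF v] by (simp add: \<gamma>_def)
  qed
  from null_homotopy_exists[OF X Xmod \<gamma> \<gamma>0 \<gamma>d]
  obtain h where h: "\<And>n. h n \<in> lin R (fm (c n)) (fm (c (Suc n)))"
    "\<And>v. v \<in> carrier (fm (c 0)) \<Longrightarrow> dC 0 (h 0 v) = \<gamma> 0 v"
    "\<And>n v. v \<in> carrier (fm (c (Suc n))) \<Longrightarrow>
       dC (Suc n) (h (Suc n) v) = \<gamma> (Suc n) v \<ominus>\<^bsub>fm (c (Suc n))\<^esub> h n (dC n v)" by blast
  have "v \<ominus>\<^bsub>fm (c n)\<^esub> dC n (h n v) \<in> fm_ideal I (c n)"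
    if v: "v \<in> carrier (fm (c n))" and av: "\<alpha> n v \<in> fm_ideal I (b n)"
      and dv: "\<forall>m. n = Suc m \<longrightarrow> dC m v \<in> fm_ideal I (c m)" for n v
  proof -
    interpret F: Module.module R "fm (c n)" by (rule fm_module)
    have ba: "\<beta> n (\<alpha> n v) \<in> fm_ideal I (c n)" by (rule lin_fm_ideal[OF I \<beta>(1) av])
    have bac: "\<beta> n (\<alpha> n v) \<in> carrier (fm (c n))" by (rule fm_ideal_carrier[OF ba])
    show ?thesis
    proof (cases n)
      case 0
      then have "dC n (h n v) = v \<ominus>\<^bsub>fm (c n)\<^esub> \<beta> n (\<alpha> n v)"
        using v h(2)[of v] by (simp add: \<gamma>_def)
      then have "v \<ominus>\<^bsub>fm (c n)\<^esub> dC n (h n v) = \<beta> n (\<alpha> n v)"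
        using F.minus_minus_cancel[OF v bac] by simp
      then show ?thesis using ba by simp
    next
      case (Suc m)
      let ?g = "h m (dC m v)"
      have g: "?g \<in> fm_ideal I (c n)" using lin_fm_ideal[OF I h(1)] dv Suc by simp
      have gc: "?g \<in> carrier (fm (c n))" by (rule fm_ideal_carrier[OF g])
      have "v \<ominus>\<^bsub>fm (c n)\<^esub> dC n (h n v) = v \<ominus>\<^bsub>fm (c n)\<^esub> (v \<ominus>\<^bsub>fm (c n)\<^esub> \<beta> n (\<alpha> n v) \<ominus>\<^bsub>fm (c n)\<^esub> ?g)"
        using h(3)[of v m] v Suc by (simp add: \<gamma>_def)
      also have "v \<ominus>\<^bsub>fm (c n)\<^esub> \<beta> n (\<alpha> n v) \<ominus>\<^bsub>fm (c n)\<^esub> ?g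
          = v \<ominus>\<^bsub>fm (c n)\<^esub> (\<beta> n (\<alpha> n v) \<oplus>\<^bsub>fm (c n)\<^esub> ?g)"
        using v bac gc by (simp add: a_minus_def F.minus_add F.a_assoc)
      also have "v \<ominus>\<^bsub>fm (c n)\<^esub> \<dots> = \<beta> n (\<alpha> n v) \<oplus>\<^bsub>fm (c n)\<^esub> ?g"
        using v bac gc by (simp add: F.minus_minus_cancel)
      finally show ?thesis using fm_ideal_add[OF I ba g] by simp
    qed
  qed
  then have "\<exists>w \<in> carrier (fm (c (Suc n))). v \<ominus>\<^bsub>fm (c n)\<^esub> dC n w \<in> fm_ideal I (c n)"
    if "v \<in> carrier (fm (c n))" "\<alpha> n v \<in> fm_ideal I (b n)"
      "\<forall>m. n = Suc m \<longrightarrow> dC m v \<in> fm_ideal I (c m)" for n v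
    using that lin_closed[OF h(1)] by blast
  then show ?thesis by (rule that[OF \<alpha>(1)])
qed

end

section \<open>The maximal ideal of a local ring\<close>

text \<open>
  Zorn's lemma: a union of a chain of ideals that avoid \<open>\<one>\<close> again avoids \<open>\<one>\<close>.
\<close>

lemma (in cring) proper_ideal_in_maximal:
  assumes J: "ideal J R" "\<one> \<notin> J"
  shows "\<exists>I. maximalideal I R \<and> J \<subseteq> I"
proof -
  let ?A = "{I. ideal I R \<and> J \<subseteq> I \<and> \<one> \<notin> I}"
  have "\<exists>I\<in>?A. \<forall>I'\<in>?A. I \<subseteq> I' \<longrightarrow> I' = I"
  proof (rule subset_Zorn_nonempty)
    show "?A \<noteq> {}" using J by blast
    fix C assume C: "C \<noteq> {}" "subset.chain ?A C"
    then have CA: "C \<subseteq> ?A" by (simp add: pred_on.chain_def)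
    have "subset.chain {I. ideal I R} C"
      using C(2) by (auto simp: pred_on.chain_def)
    then have "ideal (\<Union>C) R" using chain_Union_is_ideal C(1) by presburger
    moreover have "J \<subseteq> \<Union>C" using CA C(1) by blast
    moreover have "\<one> \<notin> \<Union>C" using CA by blast
    ultimately show "\<Union>C \<in> ?A" by simp
  qed
  then obtain I where I: "I \<in> ?A" and max': "\<forall>I'\<in>?A. I \<subseteq> I' \<longrightarrow> I' = I" ..
  have max: "\<And>I'. I' \<in> ?A \<Longrightarrow> I \<subseteq> I' \<Longrightarrow> I' = I" by (rule max'[rule_format])
  have "maximalideal I R"
  proof (rule maximalidealI)
    show "ideal I R" using I by simp
    show "carrier R \<noteq> I" using I by auto
    fix I' assume I': "ideal I' R" "I \<subseteq> I'" "I' \<subseteq> carrier R"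
    show "I' = I \<or> I' = carrier R"
    proof (cases "\<one> \<in> I'")
      case True
      then show ?thesis using ideal.one_imp_carrier[OF I'(1)] by simp
    next
      case False
      then show ?thesis using I I' max[of I'] by auto
    qed
  qed
  then show ?thesis using I by blast
qed

context noetherian_local_ring
begin

abbreviation mm :: "'a set" where "mm \<equiv> max_ideal R"

lemma max_ideal_maximal: "maximalideal mm R"
  unfolding max_ideal_def by (rule theI'[OF ex1_maximalideal])

lemma max_ideal_ideal: "ideal mm R"
  using max_ideal_maximal maximalideal.axioms(1) by blast

lemma max_ideal_proper: "\<one> \<notin> mm"
  using ideal.one_imp_carrier[OF max_ideal_ideal] maximalideal.I_notcarr[OF max_ideal_maximal] by blast

lemma outside_max_ideal_unit:
  assumes a: "a \<in> carrier R" "a \<notin> mm" shows "a \<in> Units R"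
proof (rule ccontr)
  assume nu: "a \<notin> Units R"
  have "\<one> \<notin> PIdl a"
  proof
    assume "\<one> \<in> PIdl a"
    then obtain b where b: "b \<in> carrier R" "b \<otimes> a = \<one>" by (auto simp: cgenideal_def)
    then have "a \<otimes> b = \<one>" using m_comm[of a b] a(1) by simp
    then show False using nu a(1) b unfolding Units_def by blast
  qed
  then obtain I where I: "maximalideal I R" "PIdl a \<subseteq> I"
    using proper_ideal_in_maximal[OF cgenideal_ideal[OF a(1)]] by blast
  then have "I = mm" using ex1_maximalideal max_ideal_maximal by blast
  then show False using I(2) cgenideal_self[OF a(1)] a(2) by blast
qed

end

text \<open>
  An ideal all of whose non-members are units contains every proper ideal. This form of locality
  passes easily to quotient rings.
\<close>

lemma (in cring) local_ring_criterion:
  assumes noeth: "noetherian_ring R" and I: "ideal I R" "\<one> \<notin> I"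
    and unit: "\<And>a. a \<in> carrier R \<Longrightarrow> a \<notin> I \<Longrightarrow> a \<in> Units R"
  shows "noetherian_local_ring R" and "max_ideal R = I"
proof -
  have sub: "J \<subseteq> I" if J: "ideal J R" "\<one> \<notin> J" for J
  proof
    fix a assume a: "a \<in> J"
    show "a \<in> I"
    proof (rule ccontr)
      assume "a \<notin> I"
      then have u: "a \<in> Units R" using unit ideal.Icarr[OF J(1) a] by blast
      have "inv a \<otimes> a \<in> J" using ideal.I_l_closed[OF J(1) a] u by blast
      then show False using u J(2) by simp
    qed
  qed
  have max: "maximalideal I R"
  proof (rule maximalidealI)
    show "ideal I R" by fact
    show "carrier R \<noteq> I" using I(2) by auto
    fix J assume J: "ideal J R" "I \<subseteq> J" "J \<subseteq> carrier R"
    then show "J = I \<or> J = carrier R"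
      using sub[of J] ideal.one_imp_carrier[of J R] by blast
  qed
  have uniq: "J = I" if "maximalideal J R" for J
  proof -
    interpret J: maximalideal J R by fact
    have "\<one> \<notin> J" using J.one_imp_carrier J.I_notcarr by blast
    then have "J \<subseteq> I" using sub J.is_ideal by blast
    moreover have "I \<subseteq> carrier R" using ideal.Icarr[OF I(1)] by blast
    moreover have "I \<noteq> carrier R" using I(2) by auto
    ultimately show ?thesis using J.I_maximal[OF I(1)] by blast
  qed
  have "\<exists>!I. maximalideal I R" using max uniq by blast
  then show "noetherian_local_ring R"
    using noeth by (simp add: noetherian_local_ring_def noetherian_local_ring_axioms_def is_cring)
  show "max_ideal R = I"
    unfolding max_ideal_def using max uniq by (rule the_equality)
qed

section \<open>Existence and uniqueness of minimal free resolutions\<close>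

text \<open>
  Two linear maps are allowed because two systems of equations are imposed at once on the vectors
  to be found in the mapping cone.
\<close>

lemma (in noetherian_local_ring) underdetermined:
  assumes f: "f \<in> lin R (fm n) (fm k)" and g: "g \<in> lin R (fm n) (fm l)" and less: "k + l < n"
  obtains v where "v \<in> carrier (fm n)" "v \<notin> fm_ideal mm n" "f v \<in> fm_ideal mm k" "g v \<in> fm_ideal mm l"
proof -
  define a where "a i j = (case i of Inl p \<Rightarrow> f (unit_vec n j) p | Inr q \<Rightarrow> g (unit_vec n j) q)"
    for i :: "nat + nat" and j
  have fc: "f (unit_vec n j) \<in> carrier (fm k)" for j by (rule lin_closed[OF f unit_vec_closed])
  have gc: "g (unit_vec n j) \<in> carrier (fm l)" for j by (rule lin_closed[OF g unit_vec_closed])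
  let ?E = "{..<k} <+> {..<l}"
  have "a i j \<in> carrier R" if "i \<in> ?E" for i j
    using that fm_coord[OF fc] fm_coord[OF gc] by (auto simp: a_def)
  then obtain v where v: "\<forall>j\<in>{..<n}. v j \<in> carrier R" "\<exists>j\<in>{..<n}. v j \<notin> mm"
    "\<forall>i\<in>?E. (\<Oplus>j\<in>{..<n}. a i j \<otimes> v j) \<in> mm"
    using linear_system_mod_ideal[OF max_ideal_ideal max_ideal_proper outside_max_ideal_unit,
        of ?E "{..<n}" a] less by (auto simp: card_Plus)
  let ?v = "restrict v {..<n}"
  have vc: "?v \<in> carrier (fm n)" using v(1) by (intro fm_memI) auto
  have "f ?v i \<in> mm" if i: "i < k" for i
  proof -
    have "f ?v i = (\<Oplus>j\<in>{..<n}. a (Inl i) j \<otimes> v j)"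
      unfolding lin_coord[OF f vc i]
      using v(1) fm_coord[OF fc i] by (intro finsum_cong') (auto simp: a_def)
    then show ?thesis using v(3) i by (metis InlI lessThan_iff)
  qed
  moreover have "g ?v i \<in> mm" if i: "i < l" for i
  proof -
    have "g ?v i = (\<Oplus>j\<in>{..<n}. a (Inr i) j \<otimes> v j)"
      unfolding lin_coord[OF g vc i]
      using v(1) fm_coord[OF gc i] by (intro finsum_cong') (auto simp: a_def)
    then show ?thesis using v(3) i by (metis InrI lessThan_iff)
  qed
  moreover have "?v \<notin> fm_ideal mm n" using v(2) by (auto simp: fm_ideal_def)
  ultimately show ?thesis
    using vc lin_closed[OF f vc] lin_closed[OF g vc]
    by (intro that[of ?v]) (simp_all add: fm_ideal_def)
qed

lemma (in Module.module) finsum_in_submodule: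
  assumes K: "LinearCombinations.submodule R K M" and "\<And>j. j \<in> J \<Longrightarrow> g j \<in> K"
  shows "(\<Oplus>\<^bsub>M\<^esub> j\<in>J. g j) \<in> K"
  using assms(2)
proof (induction J rule: infinite_finite_induct)
  case (insert k J)
  have "g ` insert k J \<subseteq> carrier M" using insert.prems LinearCombinations.submodule.subset[OF K] by auto
  then show ?case
    using insert LinearCombinations.submodule.m_closed[OF K]
    by (simp add: image_subset_iff Pi_iff M.finsum_insert)
qed (simp_all add: LinearCombinations.submodule.zero_closed[OF K])

context cring
begin

lemma coordinate_ideal:
  assumes K: "LinearCombinations.submodule R K (fm n)" and j: "j < n"
  shows "ideal ((\<lambda>v. v j) ` K) R"
proof -
  interpret K: LinearCombinations.submodule R K "fm n" by fact
  have c: "v j \<in> carrier R" if "v \<in> K" for v using that K.subset fm_coord j by blast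
  show ?thesis
  proof (rule idealI)
    show "ring R" by (rule ring_axioms)
    show "subgroup ((\<lambda>v. v j) ` K) (add_monoid R)"
    proof (rule add.subgroupI)
      show "(\<lambda>v. v j) ` K \<subseteq> carrier R" using c by auto
      show "(\<lambda>v. v j) ` K \<noteq> {}" using K.zero_closed by blast
      fix a assume "a \<in> (\<lambda>v. v j) ` K"
      then obtain v where v: "v \<in> K" "a = v j" by blast
      then have "(\<ominus> \<one>) \<odot>\<^bsub>fm n\<^esub> v \<in> K" by simp
      moreover have "((\<ominus> \<one>) \<odot>\<^bsub>fm n\<^esub> v) j = \<ominus> a"
        using v c j by (simp add: fm_smult l_minus)
      ultimately show "\<ominus> a \<in> (\<lambda>v. v j) ` K" by (metis imageI)
    next
      fix a b assume "a \<in> (\<lambda>v. v j) ` K" "b \<in> (\<lambda>v. v j) ` K"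
      then obtain v w where vw: "v \<in> K" "a = v j" "w \<in> K" "b = w j" by blast
      then have "v \<oplus>\<^bsub>fm n\<^esub> w \<in> K" "(v \<oplus>\<^bsub>fm n\<^esub> w) j = a \<oplus> b" using j by (simp_all add: fm_add)
      then show "a \<oplus> b \<in> (\<lambda>v. v j) ` K" by (metis imageI)
    qed
    fix a r assume "a \<in> (\<lambda>v. v j) ` K" and r: "r \<in> carrier R"
    then obtain v where v: "v \<in> K" "a = v j" by blast
    then have "r \<odot>\<^bsub>fm n\<^esub> v \<in> K" "(r \<odot>\<^bsub>fm n\<^esub> v) j = r \<otimes> a" using j r by (simp_all add: fm_smult)
    then show "r \<otimes> a \<in> (\<lambda>v. v j) ` K" by (metis imageI)
    then show "a \<otimes> r \<in> (\<lambda>v. v j) ` K" using m_comm[of r a] r v c by simp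
  qed
qed

text \<open>
  Leading-coefficient argument, applied to coordinates. The vectors of \<open>K\<close> supported below
  \<open>j + 1\<close> have \<open>j\<close>-th coordinates forming an ideal. Finitely many vectors whose coordinates
  generate this ideal reduce any other vector to one supported below \<open>j\<close>.
\<close>

lemma noetherian_free_submodule_fg:
  assumes noeth: "noetherian_ring R" and K: "LinearCombinations.submodule R K (fm n)"
  shows "\<exists>G. finite G \<and> G \<subseteq> K \<and> K \<subseteq> LinearCombinations.module.span R (fm n) G"
proof -
  interpret F: Module.module R "fm n" by (rule fm_module)
  interpret K: LinearCombinations.submodule R K "fm n" by fact
  define KK where "KK j = {v \<in> K. \<forall>i<n. j \<le> i \<longrightarrow> v i = \<zero>}" for j
  have KK: "LinearCombinations.submodule R (KK j) (fm n)" for j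
  proof
    show "KK j \<subseteq> carrier (fm n)" using K.subset by (auto simp: KK_def)
  qed (auto simp: KK_def fm_simps)
  have span_sub: "LinearCombinations.submodule R (F.span G) (fm n)" if "G \<subseteq> K" for G
    using F.span_is_submodule that K.subset by blast
  have "\<exists>G. finite G \<and> G \<subseteq> K \<and> KK j \<subseteq> F.span G" if "j \<le> n" for j
    using that
  proof (induction j)
    case 0
    have "v \<in> F.span {}" if v: "v \<in> KK 0" for v
    proof -
      have "v = \<zero>\<^bsub>fm n\<^esub>"
        using v K.subset by (intro fm_eqI) (auto simp: KK_def fm_zero)
      then show ?thesis using LinearCombinations.submodule.zero_closed[OF span_sub[of "{}"]] by simp
    qed
    then show ?case by blast
  next
    case (Suc j)
    then obtain G where G: "finite G" "G \<subseteq> K" "KK j \<subseteq> F.span G" by auto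
    have j: "j < n" using Suc.prems by simp
    obtain A where A: "A \<subseteq> carrier R" "finite A" "(\<lambda>v. v j) ` KK (Suc j) = Idl A"
      using noetherian_ring.finetely_gen[OF noeth coordinate_ideal[OF KK j, of "Suc j"]] by blast
    then have "A \<subseteq> (\<lambda>v. v j) ` KK (Suc j)" using genideal_self by simp
    then obtain V where V: "V \<subseteq> KK (Suc j)" "finite V" "A = (\<lambda>v. v j) ` V"
      using finite_subset_image[OF A(2)] by blast
    have VK: "V \<subseteq> K" using V(1) by (auto simp: KK_def)
    have "A \<subseteq> (\<lambda>v. v j) ` F.span V"
      using V(3) F.in_own_span[of V] VK K.subset by blast
    then have lead: "(\<lambda>v. v j) ` KK (Suc j) \<subseteq> (\<lambda>v. v j) ` F.span V"
      unfolding A(3) by (rule genideal_minimal[OF coordinate_ideal[OF span_sub[OF VK] j]])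
    have GV: "G \<union> V \<subseteq> K" using G VK by blast
    have sV: "F.span V \<subseteq> F.span (G \<union> V)" and sG: "F.span G \<subseteq> F.span (G \<union> V)"
      by (rule F.span_is_monotone, simp)+
    have "v \<in> F.span (G \<union> V)" if v: "v \<in> KK (Suc j)" for v
    proof -
      obtain w where w: "w \<in> F.span V" "v j = w j" using lead v by blast
      have wKK: "w \<in> KK (Suc j)" using F.span_is_subset[OF V(1) KK] w(1) by blast
      have vc: "v \<in> carrier (fm n)" "w \<in> carrier (fm n)" using v wKK K.subset by (auto simp: KK_def)
      have "v \<ominus>\<^bsub>fm n\<^esub> w = v \<oplus>\<^bsub>fm n\<^esub> (\<ominus> \<one>) \<odot>\<^bsub>fm n\<^esub> w"
        using vc by (simp add: a_minus_def F.smult_minus_1)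
      then have K1: "v \<ominus>\<^bsub>fm n\<^esub> w \<in> KK (Suc j)"
        using v wKK LinearCombinations.submodule.m_closed[OF KK]
          LinearCombinations.submodule.smult_closed[OF KK, of "\<ominus> \<one>"] by simp
      have "(v \<ominus>\<^bsub>fm n\<^esub> w) j = \<zero>" using vc j w(2) fm_coord[OF vc(2) j] by (simp add: fm_minus)
      then have "v \<ominus>\<^bsub>fm n\<^esub> w \<in> KK j" using K1 by (auto simp: KK_def le_Suc_eq) (metis Suc_leI le_neq_implies_less)
      then have "v \<ominus>\<^bsub>fm n\<^esub> w \<in> F.span (G \<union> V)" using G(3) sG by blast
      moreover have "w \<in> F.span (G \<union> V)" using w(1) sV by blast
      moreover have "v = (v \<ominus>\<^bsub>fm n\<^esub> w) \<oplus>\<^bsub>fm n\<^esub> w" using vc by (simp add: a_minus_def F.a_assoc F.l_neg)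
      ultimately show ?thesis
        using LinearCombinations.submodule.m_closed[OF span_sub[OF GV]] by metis
    qed
    then show ?case using G(1) V(2) GV by blast
  qed
  from this[of n] obtain G where "finite G" "G \<subseteq> K" "KK n \<subseteq> F.span G" by auto
  moreover have "KK n = K" by (auto simp: KK_def)
  ultimately show ?thesis by blast
qed

end

context noetherian_local_ring
begin

text \<open>
  A generating set of least cardinality is used. A relation with a unit coefficient would express
  one generator through the others, so all relations have coefficients in the maximal ideal.
\<close>

lemma minimal_cover:
  assumes X: "Module.module R X" and fg: "finitely_generated R X"
  shows "\<exists>n. \<exists>\<epsilon> \<in> lin R (fm n) X. \<epsilon> ` carrier (fm n) = carrier X \<and>
           (\<forall>v \<in> carrier (fm n). \<epsilon> v = \<zero>\<^bsub>X\<^esub> \<longrightarrow> v \<in> fm_ideal mm n)"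
proof -
  interpret X: Module.module R X by fact
  let ?P = "\<lambda>n. \<exists>G. finite G \<and> card G = n \<and> G \<subseteq> carrier X \<and> X.span G = carrier X"
  define n where "n = (LEAST n. ?P n)"
  have "\<exists>n. ?P n" using fg unfolding finitely_generated_def by blast
  then have "?P n" unfolding n_def by (rule LeastI_ex)
  then obtain G where G: "finite G" "card G = n" "G \<subseteq> carrier X" "X.span G = carrier X" by blast
  have least: "n \<le> card T" if "finite T" "T \<subseteq> carrier X" "X.span T = carrier X" for T
    unfolding n_def by (rule Least_le) (use that in blast)
  obtain g where g: "bij_betw g {..<n} G"
    using ex_bij_betw_nat_finite[OF G(1)] G(2) by (auto simp: atLeast0LessThan)
  have gG: "g i \<in> G" if "i < n" for i using g that bij_betwE by fastforce
  then have gc: "g i \<in> carrier X" if "i < n" for i using that G(3) by blast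
  define \<epsilon> where "\<epsilon> = (\<lambda>v. \<Oplus>\<^bsub>X\<^esub> i\<in>{..<n}. v i \<odot>\<^bsub>X\<^esub> g i)"
  have \<epsilon>: "\<epsilon> \<in> lin R (fm n) X" unfolding \<epsilon>_def by (rule lin_from_basis[OF X gc])
  have \<epsilon>_unit: "\<epsilon> (unit_vec n j) = g j" if "j < n" for j
    unfolding \<epsilon>_def by (rule lin_from_basis_unit[OF X gc that])
  have im_sub: "LinearCombinations.submodule R (\<epsilon> ` carrier (fm n)) X"
    using mod_hom.im_is_submodule[OF lin_mod_hom[OF fm_module X \<epsilon>]]
    by (simp add: mod_hom.im_def[OF lin_mod_hom[OF fm_module X \<epsilon>]])
  have "G \<subseteq> \<epsilon> ` carrier (fm n)"
  proof
    fix y assume "y \<in> G"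
    then obtain i where "i < n" "y = g i" using g by (auto simp: bij_betw_def)
    then show "y \<in> \<epsilon> ` carrier (fm n)" using \<epsilon>_unit[of i] unit_vec_closed[of n i] by (metis imageI)
  qed
  then have "carrier X \<subseteq> \<epsilon> ` carrier (fm n)" using X.span_is_subset[OF _ im_sub] G(4) by blast
  then have onto: "\<epsilon> ` carrier (fm n) = carrier X" using lin_closed[OF \<epsilon>] by blast
  have "v i \<in> mm" if v: "v \<in> carrier (fm n)" "\<epsilon> v = \<zero>\<^bsub>X\<^esub>" and i: "i < n" for v i
  proof (rule ccontr)
    assume "v i \<notin> mm"
    then have u: "v i \<in> Units R" using outside_max_ideal_unit fm_coord[OF v(1) i] by blast
    define T where "T = G - {g i}"
    have T: "finite T" "T \<subseteq> carrier X" "G = insert (g i) T"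
      using G gG[OF i] by (auto simp: T_def)
    have cardT: "card T < n" using card_Diff1_less[OF G(1) gG[OF i]] G(2) by (simp add: T_def)
    have sT: "LinearCombinations.submodule R (X.span T) X" by (rule X.span_is_submodule[OF T(2)])
    have TT: "T \<subseteq> X.span T" by (rule X.in_own_span[OF T(2)])
    have gT: "g j \<in> T" if "j \<in> {..<n} - {i}" for j
      using that gG i g by (auto simp: T_def bij_betw_def inj_on_def)
    define s where "s = (\<Oplus>\<^bsub>X\<^esub> j\<in>{..<n} - {i}. v j \<odot>\<^bsub>X\<^esub> g j)"
    have s: "s \<in> X.span T"
      unfolding s_def using gT TT fm_coord[OF v(1)]
      by (intro X.finsum_in_submodule[OF sT] LinearCombinations.submodule.smult_closed[OF sT]) auto
    then have sc: "s \<in> carrier X" using X.span_is_subset2[OF T(2)] by blast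
    have vi: "v i \<in> carrier R" using fm_coord[OF v(1) i] .
    have gi: "g i \<in> carrier X" using gc[OF i] .
    have "{..<n} = insert i ({..<n} - {i})" using i by auto
    then have "\<epsilon> v = (\<Oplus>\<^bsub>X\<^esub> j\<in>insert i ({..<n} - {i}). v j \<odot>\<^bsub>X\<^esub> g j)" by (simp add: \<epsilon>_def)
    also have "\<dots> = v i \<odot>\<^bsub>X\<^esub> g i \<oplus>\<^bsub>X\<^esub> s"
      unfolding s_def using gc fm_coord[OF v(1)] vi gi by (intro X.finsum_insert) auto
    finally have "v i \<odot>\<^bsub>X\<^esub> g i \<oplus>\<^bsub>X\<^esub> s = \<zero>\<^bsub>X\<^esub>" using v(2) by simp
    then have "v i \<odot>\<^bsub>X\<^esub> g i = \<ominus>\<^bsub>X\<^esub> s"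
      using X.M.minus_equality[of "v i \<odot>\<^bsub>X\<^esub> g i" s] sc vi gi by simp
    then have "inv (v i) \<odot>\<^bsub>X\<^esub> (v i \<odot>\<^bsub>X\<^esub> g i) = inv (v i) \<odot>\<^bsub>X\<^esub> ((\<ominus> \<one>) \<odot>\<^bsub>X\<^esub> s)"
      using X.smult_minus_1[OF sc] by simp
    moreover have "inv (v i) \<odot>\<^bsub>X\<^esub> (v i \<odot>\<^bsub>X\<^esub> g i) = g i"
      using u vi gi by (simp add: X.smult_assoc1[symmetric])
    moreover have "inv (v i) \<odot>\<^bsub>X\<^esub> ((\<ominus> \<one>) \<odot>\<^bsub>X\<^esub> s) \<in> X.span T"
      using s u by (intro LinearCombinations.submodule.smult_closed[OF sT]) auto
    ultimately have "g i \<in> X.span T" by simp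
    then have "G \<subseteq> X.span T" using T(3) TT by blast
    then have "carrier X \<subseteq> X.span T" using X.span_is_subset[OF _ sT] G(4) by blast
    then have "X.span T = carrier X" using X.span_is_subset2[OF T(2)] by blast
    then show False using least[OF T(1,2)] cardT by simp
  qed
  then have "v \<in> fm_ideal mm n" if "v \<in> carrier (fm n)" "\<epsilon> v = \<zero>\<^bsub>X\<^esub>" for v
    using that by (simp add: fm_ideal_def)
  then show ?thesis using \<epsilon> onto by (intro exI[of _ n] bexI[of _ \<epsilon>]) auto
qed

lemma minimal_cover_submodule:
  assumes K: "LinearCombinations.submodule R K (fm n)"
  shows "\<exists>k. \<exists>\<delta> \<in> lin R (fm k) (fm n). \<delta> ` carrier (fm k) = K \<and>
           (\<forall>v \<in> carrier (fm k). \<delta> v = \<zero>\<^bsub>fm n\<^esub> \<longrightarrow> v \<in> fm_ideal mm k)"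
proof -
  interpret F: Module.module R "fm n" by (rule fm_module)
  obtain G where G: "finite G" "G \<subseteq> K" "K \<subseteq> F.span G"
    using noetherian_free_submodule_fg[OF noetherian_ring_axioms K] by blast
  have KX: "Module.module R (F.md K)" by (rule F.submodule_is_module[OF K])
  have "LinearCombinations.module.span R (F.md K) G = K"
    using F.span_li_not_depend(1)[OF G(2) K] F.span_is_subset[OF G(2) K] G(3) by blast
  then have fg: "finitely_generated R (F.md K)"
    unfolding finitely_generated_def using G(1,2) by auto
  have inc: "\<delta> \<in> lin R (fm k) (fm n)" if "\<delta> \<in> lin R (fm k) (F.md K)" for k \<delta>
    using that LinearCombinations.submodule.subset[OF K]
    by (auto simp: LinearCombinations.module_hom_def)
  from minimal_cover[OF KX fg] obtain k \<delta> where "\<delta> \<in> lin R (fm k) (F.md K)"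
    "\<delta> ` carrier (fm k) = K" "\<forall>v \<in> carrier (fm k). \<delta> v = \<zero>\<^bsub>fm n\<^esub> \<longrightarrow> v \<in> fm_ideal mm k"
    by auto
  then show ?thesis using inc by blast
qed

text \<open>
  Minimal covers are spliced: each one covers the kernel of the one before, which is finitely
  generated as a submodule of a free module.
\<close>

theorem minimal_free_resolution_exists:
  assumes X: "Module.module R X" and fg: "finitely_generated R X"
  shows "\<exists>b d \<epsilon>. minimal_free_resolution R X b d \<epsilon>"
proof -
  obtain b0 \<epsilon> where \<epsilon>: "\<epsilon> \<in> lin R (fm b0) X" "\<epsilon> ` carrier (fm b0) = carrier X"
    and \<epsilon>min: "\<And>v. v \<in> carrier (fm b0) \<Longrightarrow> \<epsilon> v = \<zero>\<^bsub>X\<^esub> \<Longrightarrow> v \<in> fm_ideal mm b0"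
    using minimal_cover[OF X fg] by blast
  \<comment> \<open>A state \<open>(k, n, \<delta>)\<close> records the source rank and the target rank of a differential \<open>\<delta>\<close>.\<close>
  define P where "P m s \<longleftrightarrow> (case s of (k, n, \<delta>) \<Rightarrow> \<delta> \<in> lin R (fm k) (fm n) \<and>
      (\<forall>v \<in> carrier (fm k). \<delta> v = \<zero>\<^bsub>fm n\<^esub> \<longrightarrow> v \<in> fm_ideal mm k) \<and>
      (m = 0 \<longrightarrow> n = b0 \<and> \<delta> ` carrier (fm k) = a_kernel (fm b0) X \<epsilon>))"
    for m :: nat and s :: "nat \<times> nat \<times> ((nat \<Rightarrow> 'a) \<Rightarrow> (nat \<Rightarrow> 'a))"
  define Q where "Q m s s' \<longleftrightarrow> (case s of (k, n, \<delta>) \<Rightarrow> case s' of (k', n', \<delta>') \<Rightarrow>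
      n' = k \<and> \<delta>' ` carrier (fm k') = a_kernel (fm k) (fm n) \<delta>)"
    for m :: nat and s s' :: "nat \<times> nat \<times> ((nat \<Rightarrow> 'a) \<Rightarrow> (nat \<Rightarrow> 'a))"
  have "\<exists>s. P 0 s"
  proof -
    from minimal_cover_submodule[OF kernel_submodule[OF fm_module X \<epsilon>(1)]]
    obtain k \<delta> where "P 0 (k, b0, \<delta>)" by (auto simp: P_def)
    then show ?thesis by blast
  qed
  moreover have "\<exists>s'. P (Suc m) s' \<and> Q m s s'" if "P m s" for m s
  proof -
    obtain k n \<delta> where s: "s = (k, n, \<delta>)" by (cases s)
    then have \<delta>: "\<delta> \<in> lin R (fm k) (fm n)" using that by (simp add: P_def)
    from minimal_cover_submodule[OF kernel_submodule[OF fm_module fm_module \<delta>]]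
    obtain k' \<delta>' where "P (Suc m) (k', k, \<delta>') \<and> Q m s (k', k, \<delta>')" by (auto simp: P_def Q_def s)
    then show ?thesis by blast
  qed
  ultimately obtain s where PQ: "\<And>m. P m (s m) \<and> Q m (s m) (s (Suc m))"
    using dependent_nat_choice[of P Q] by metis
  define b where "b m = fst (snd (s m))" for m
  define d where "d m = snd (snd (s m))" for m
  have s: "s m = (b (Suc m), b m, d m)" for m
    using PQ[of m] by (cases "s m", cases "s (Suc m)") (auto simp: b_def d_def Q_def)
  have b0: "b 0 = b0" and d0: "d 0 ` carrier (fm (b (Suc 0))) = a_kernel (fm b0) X \<epsilon>"
    using PQ[of 0] by (simp_all add: P_def s)
  have dlin: "d m \<in> lin R (fm (b (Suc m))) (fm (b m))" for m
    using PQ[of m] by (simp add: P_def s)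
  have dmin: "v \<in> fm_ideal mm (b (Suc m))"
    if "v \<in> carrier (fm (b (Suc m)))" "d m v = \<zero>\<^bsub>fm (b m)\<^esub>" for m v
    using PQ[of m] that by (simp add: P_def s)
  have dex: "d (Suc m) ` carrier (fm (b (Suc (Suc m)))) = a_kernel (fm (b (Suc m))) (fm (b m)) (d m)" for m
    using PQ[of m] by (simp add: Q_def s)
  have res: "free_resolution R X b d \<epsilon>"
    unfolding free_resolution_def using \<epsilon> b0 d0 dlin dex by simp
  have "d m v i \<in> mm" if v: "v \<in> carrier (fm (b (Suc m)))" and i: "i < b m" for m v i
  proof (cases m)
    case 0
    then have "d m v \<in> carrier (fm b0)" "\<epsilon> (d m v) = \<zero>\<^bsub>X\<^esub>"
      using lin_closed[OF dlin v] resolution_comp_0[OF res, of v] v b0 by auto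
    from \<epsilon>min[OF this] show ?thesis using i 0 b0 by (simp add: fm_ideal_def)
  next
    case (Suc l)
    then have "d m v \<in> carrier (fm (b (Suc l)))" "d l (d m v) = \<zero>\<^bsub>fm (b l)\<^esub>"
      using lin_closed[OF dlin v] resolution_comp_Suc[OF res, of v l] v by auto
    from dmin[OF this] show ?thesis using i Suc by (simp add: fm_ideal_def)
  qed
  then have "minimal_free_resolution R X b d \<epsilon>" using res by (simp add: minimal_free_resolution_def)
  then show ?thesis by blast
qed

lemma minimal_diff_in_ideal:
  assumes "minimal_free_resolution R X b d \<epsilon>" "v \<in> carrier (fm (b (Suc n)))"
  shows "d n v \<in> fm_ideal mm (b n)"
proof -
  from lin_closed[OF resolution_diff[OF minimal_is_resolution[OF assms(1)]] assms(2)]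
  show ?thesis using assms by (simp add: fm_ideal_def minimal_free_resolution_def)
qed

text \<open>
  A vector that is not zero modulo \<open>\<mm>\<close> but is sent into \<open>\<mm>\<close> by the comparison map would be
  a boundary modulo \<open>\<mm>\<close>, and boundaries of a minimal resolution lie in \<open>\<mm>\<close>.
\<close>

lemma minimal_rank_le:
  assumes min: "minimal_free_resolution R X b d \<epsilon>" and Y: "free_resolution R X c d' \<epsilon>'"
    and Xmod: "Module.module R X"
  shows "b n \<le> c n"
proof (rule ccontr)
  assume "\<not> b n \<le> c n"
  then have less: "c n + 0 < b n" by simp
  show False
  proof (rule tor_injective[OF minimal_is_resolution[OF min] Y Xmod max_ideal_ideal])
    fix \<alpha>
    assume \<alpha>: "\<And>n. \<alpha> n \<in> lin R (fm (b n)) (fm (c n))"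
      "\<And>n v. v \<in> carrier (fm (b n)) \<Longrightarrow> \<alpha> n v \<in> fm_ideal mm (c n) \<Longrightarrow>
         (\<forall>m. n = Suc m \<longrightarrow> d m v \<in> fm_ideal mm (b m)) \<Longrightarrow>
         \<exists>w \<in> carrier (fm (b (Suc n))). v \<ominus>\<^bsub>fm (b n)\<^esub> d n w \<in> fm_ideal mm (b n)"
    have "(\<lambda>_. \<zero>\<^bsub>fm 0\<^esub>) \<in> lin R (fm (b n)) (fm 0)"
      by (rule lin_zero_map[OF fm_module])
    then obtain v where v: "v \<in> carrier (fm (b n))" "v \<notin> fm_ideal mm (b n)"
      "\<alpha> n v \<in> fm_ideal mm (c n)" "\<zero>\<^bsub>fm 0\<^esub> \<in> fm_ideal mm 0"
      by (rule underdetermined[OF \<alpha>(1) _ less])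
    have "\<forall>m. n = Suc m \<longrightarrow> d m v \<in> fm_ideal mm (b m)"
      using minimal_diff_in_ideal[OF min] v(1) by blast
    from \<alpha>(2)[OF v(1,3) this] obtain w where w: "w \<in> carrier (fm (b (Suc n)))"
      "v \<ominus>\<^bsub>fm (b n)\<^esub> d n w \<in> fm_ideal mm (b n)" by blast
    from fm_ideal_minus_cancel[OF max_ideal_ideal v(1) minimal_diff_in_ideal[OF min w(1)] w(2)] v(2)
    show False by blast
  qed
qed

lemma betti_eq:
  assumes min: "minimal_free_resolution R X b d \<epsilon>" and Xmod: "Module.module R X"
  shows "betti R X n = b n"
  unfolding betti_def
proof (rule the_equality)
  show "\<exists>b' d' \<epsilon>'. minimal_free_resolution R X b' d' \<epsilon>' \<and> b n = b' n" using min by blast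
  fix r assume "\<exists>b' d' \<epsilon>'. minimal_free_resolution R X b' d' \<epsilon>' \<and> r = b' n"
  then obtain b' d' \<epsilon>' where m: "minimal_free_resolution R X b' d' \<epsilon>'" "r = b' n" by blast
  have "b n \<le> b' n" "b' n \<le> b n"
    using minimal_rank_le[OF min minimal_is_resolution[OF m(1)] Xmod]
      minimal_rank_le[OF m(1) minimal_is_resolution[OF min] Xmod] .
  then show "r = b n" using m(2) by simp
qed

end

section \<open>The mapping cone of a map of resolutions\<close>

context cring
begin

definition vec_fst :: "nat \<Rightarrow> (nat \<Rightarrow> 'a) \<Rightarrow> nat \<Rightarrow> 'a"
  where "vec_fst k v = restrict v {..<k}"

definition vec_snd :: "nat \<Rightarrow> nat \<Rightarrow> (nat \<Rightarrow> 'a) \<Rightarrow> nat \<Rightarrow> 'a"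
  where "vec_snd k l v = (\<lambda>i\<in>{..<l}. v (k + i))"

definition vec_pair :: "nat \<Rightarrow> nat \<Rightarrow> (nat \<Rightarrow> 'a) \<Rightarrow> (nat \<Rightarrow> 'a) \<Rightarrow> nat \<Rightarrow> 'a"
  where "vec_pair k l u w = (\<lambda>i\<in>{..<k + l}. if i < k then u i else w (i - k))"

lemma vec_fst_lin: "vec_fst k \<in> lin R (fm (k + l)) (fm k)"
proof (rule lin_coordwiseI[OF fm_module])
  show "vec_fst k v \<in> carrier (fm k)" if "v \<in> carrier (fm (k + l))" for v
    unfolding vec_fst_def using fm_coord[OF that] by (intro fm_memI) simp
qed (simp_all add: vec_fst_def fm_add fm_smult)

lemma vec_snd_lin: "vec_snd k l \<in> lin R (fm (k + l)) (fm l)"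
proof (rule lin_coordwiseI[OF fm_module])
  show "vec_snd k l v \<in> carrier (fm l)" if "v \<in> carrier (fm (k + l))" for v
    unfolding vec_snd_def using fm_coord[OF that] by (intro fm_memI) simp
qed (simp_all add: vec_snd_def fm_add fm_smult)

lemma vec_pair_closed:
  "u \<in> carrier (fm k) \<Longrightarrow> w \<in> carrier (fm l) \<Longrightarrow> vec_pair k l u w \<in> carrier (fm (k + l))"
  unfolding vec_pair_def by (rule fm_memI) (auto intro: fm_coord)

lemma vec_pair_lin:
  assumes X: "Module.module R X" and f: "f \<in> lin R X (fm k)" and g: "g \<in> lin R X (fm l)"
  shows "(\<lambda>v. vec_pair k l (f v) (g v)) \<in> lin R X (fm (k + l))"
proof (rule lin_coordwiseI[OF X])
  show "vec_pair k l (f v) (g v) \<in> carrier (fm (k + l))" if "v \<in> carrier X" for v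
    by (rule vec_pair_closed[OF lin_closed[OF f that] lin_closed[OF g that]])
next
  fix v w i assume "v \<in> carrier X" "w \<in> carrier X" "i < k + l"
  then show "vec_pair k l (f (v \<oplus>\<^bsub>X\<^esub> w)) (g (v \<oplus>\<^bsub>X\<^esub> w)) i
      = vec_pair k l (f v) (g v) i \<oplus> vec_pair k l (f w) (g w) i"
    by (simp add: LinearCombinations.module_hom_add[OF f] LinearCombinations.module_hom_add[OF g]
        vec_pair_def fm_add)
next
  fix a v i assume "a \<in> carrier R" "v \<in> carrier X" "i < k + l"
  then show "vec_pair k l (f (a \<odot>\<^bsub>X\<^esub> v)) (g (a \<odot>\<^bsub>X\<^esub> v)) i = a \<otimes> vec_pair k l (f v) (g v) i"
    by (simp add: LinearCombinations.module_hom_smult[OF f] LinearCombinations.module_hom_smult[OF g]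
        vec_pair_def fm_smult)
qed

lemma vec_fst_pair: "u \<in> carrier (fm k) \<Longrightarrow> vec_fst k (vec_pair k l u w) = u"
  by (rule ext) (auto simp: vec_fst_def vec_pair_def fm_carrier PiE_def extensional_def)

lemma vec_snd_pair: "w \<in> carrier (fm l) \<Longrightarrow> vec_snd k l (vec_pair k l u w) = w"
  by (rule ext) (auto simp: vec_snd_def vec_pair_def fm_carrier PiE_def extensional_def)

lemma vec_pair_split: "v \<in> carrier (fm (k + l)) \<Longrightarrow> vec_pair k l (vec_fst k v) (vec_snd k l v) = v"
  by (rule ext) (auto simp: vec_fst_def vec_snd_def vec_pair_def fm_carrier PiE_def extensional_def)

lemma vec_pair_zero: "vec_pair k l \<zero>\<^bsub>fm k\<^esub> \<zero>\<^bsub>fm l\<^esub> = \<zero>\<^bsub>fm (k + l)\<^esub>"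
  by (rule ext) (auto simp: vec_pair_def func_space_def)

lemma vec_pair_fm_ideal:
  "u \<in> fm_ideal I k \<Longrightarrow> w \<in> fm_ideal I l \<Longrightarrow> vec_pair k l u w \<in> fm_ideal I (k + l)"
  by (simp add: fm_ideal_def vec_pair_closed) (auto simp: vec_pair_def)

lemma vec_snd_fm_ideal: "ideal I R \<Longrightarrow> v \<in> fm_ideal I (k + l) \<Longrightarrow> vec_snd k l v \<in> fm_ideal I l"
  by (rule lin_fm_ideal[OF _ vec_snd_lin])

end

locale resolution_map = cring R for R (structure) +
  fixes N :: "('a, 'n, 'p) module_scheme" and F :: "('a, 'f, 's) module_scheme"
    and p dP \<epsilon>P q dQ \<epsilon>Q \<iota> f
  assumes N: "Module.module R N" and F: "Module.module R F"
    and P: "free_resolution R N p dP \<epsilon>P" and Q: "free_resolution R F q dQ \<epsilon>Q"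
    and \<iota>: "\<iota> \<in> lin R N F"
    and f: "f n \<in> lin R (fm (p n)) (fm (q n))"
    and f0: "v \<in> carrier (fm (p 0)) \<Longrightarrow> \<epsilon>Q (f 0 v) = \<iota> (\<epsilon>P v)"
    and fd: "v \<in> carrier (fm (p (Suc n))) \<Longrightarrow> dQ n (f (Suc n) v) = f n (dP n v)"
begin

text \<open>
  The cone is \<open>Q\<^sub>n \<oplus> P\<^sub>n\<^sub>-\<^sub>1\<close> with differential
  \<open>(u, w) \<mapsto> (d u + f w, - d w)\<close>; in degree \<open>0\<close> the second summand is absent. The first
  component makes sense in all degrees and is kept as \<open>cone_top\<close>.
\<close>

definition cone_rank :: "nat \<Rightarrow> nat"
  where "cone_rank n = (case n of 0 \<Rightarrow> q 0 | Suc m \<Rightarrow> q (Suc m) + p m)"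

definition cone_top :: "nat \<Rightarrow> (nat \<Rightarrow> 'a) \<Rightarrow> nat \<Rightarrow> 'a"
  where "cone_top n v = dQ n (vec_fst (q (Suc n)) v) \<oplus>\<^bsub>fm (q n)\<^esub> f n (vec_snd (q (Suc n)) (p n) v)"

definition cone_diff :: "nat \<Rightarrow> (nat \<Rightarrow> 'a) \<Rightarrow> nat \<Rightarrow> 'a"
  where "cone_diff n v = (case n of 0 \<Rightarrow> cone_top 0 v
     | Suc m \<Rightarrow> vec_pair (q (Suc m)) (p m) (cone_top (Suc m) v)
                 (\<ominus>\<^bsub>fm (p m)\<^esub> dP m (vec_snd (q (Suc (Suc m))) (p (Suc m)) v)))"

lemma cone_rank_simps: "cone_rank 0 = q 0" "cone_rank (Suc n) = q (Suc n) + p n"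
  by (simp_all add: cone_rank_def)

lemma cone_diff_simps:
  "cone_diff 0 v = cone_top 0 v"
  "cone_diff (Suc n) v = vec_pair (q (Suc n)) (p n) (cone_top (Suc n) v)
     (\<ominus>\<^bsub>fm (p n)\<^esub> dP n (vec_snd (q (Suc (Suc n))) (p (Suc n)) v))"
  by (simp_all add: cone_diff_def)

lemma cone_top_lin: "cone_top n \<in> lin R (fm (q (Suc n) + p n)) (fm (q n))"
  unfolding cone_top_def
  by (rule lin_add[OF fm_module fm_module lin_comp[OF vec_fst_lin resolution_diff[OF Q]]
        lin_comp[OF vec_snd_lin f]])

lemma cone_diff_lin: "cone_diff n \<in> lin R (fm (cone_rank (Suc n))) (fm (cone_rank n))"
proof (cases n)
  case 0
  have "cone_diff 0 = cone_top 0" by (rule ext) (simp add: cone_diff_simps)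
  then show ?thesis using cone_top_lin[of 0] 0 by (simp add: cone_rank_simps)
next
  case (Suc m)
  then show ?thesis
    unfolding cone_diff_def
    using vec_pair_lin[OF fm_module cone_top_lin[of "Suc m"]
        lin_uminus[OF fm_module lin_comp[OF vec_snd_lin resolution_diff[OF P]]]]
    by (simp add: cone_rank_simps)
qed

lemma cone_top_pair:
  assumes "u \<in> carrier (fm (q (Suc n)))" "w \<in> carrier (fm (p n))"
  shows "cone_top n (vec_pair (q (Suc n)) (p n) u w) = dQ n u \<oplus>\<^bsub>fm (q n)\<^esub> f n w"
  using assms by (simp add: cone_top_def vec_fst_pair vec_snd_pair)

lemma cone_diff_pair:
  assumes "u \<in> carrier (fm (q (Suc (Suc n))))" "w \<in> carrier (fm (p (Suc n)))"
  shows "cone_diff (Suc n) (vec_pair (q (Suc (Suc n))) (p (Suc n)) u w)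
    = vec_pair (q (Suc n)) (p n) (dQ (Suc n) u \<oplus>\<^bsub>fm (q (Suc n))\<^esub> f (Suc n) w) (\<ominus>\<^bsub>fm (p n)\<^esub> dP n w)"
  using assms by (simp add: cone_diff_simps cone_top_pair vec_snd_pair)

lemma cone_top_top:
  assumes u: "u \<in> carrier (fm (q (Suc (Suc n))))" and w: "w \<in> carrier (fm (p (Suc n)))"
  shows "dQ n (dQ (Suc n) u \<oplus>\<^bsub>fm (q (Suc n))\<^esub> f (Suc n) w) \<oplus>\<^bsub>fm (q n)\<^esub> f n (\<ominus>\<^bsub>fm (p n)\<^esub> dP n w) = \<zero>\<^bsub>fm (q n)\<^esub>"
proof -
  interpret A: Module.module R "fm (q n)" by (rule fm_module)
  note dP = resolution_diff[OF P] and dQ = resolution_diff[OF Q]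
  have "dQ n (dQ (Suc n) u \<oplus>\<^bsub>fm (q (Suc n))\<^esub> f (Suc n) w)
      = dQ n (dQ (Suc n) u) \<oplus>\<^bsub>fm (q n)\<^esub> dQ n (f (Suc n) w)"
    by (rule LinearCombinations.module_hom_add[OF dQ lin_closed[OF dQ u] lin_closed[OF f w]])
  also have "\<dots> = f n (dP n w)"
    using resolution_comp_Suc[OF Q u] fd[OF w] lin_closed[OF f lin_closed[OF dP w]] by simp
  finally show ?thesis
    using lin_neg[OF fm_module fm_module f lin_closed[OF dP w]] lin_closed[OF f lin_closed[OF dP w]]
    by (simp add: A.r_neg)
qed

lemma cone_top_preimage:
  assumes u: "u \<in> carrier (fm (q (Suc n)))" and w: "w \<in> carrier (fm (p (Suc n)))"
    and z: "dQ n u = f n (dP n w)"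
  shows "\<exists>u' \<in> carrier (fm (q (Suc (Suc n)))). dQ (Suc n) u' \<oplus>\<^bsub>fm (q (Suc n))\<^esub> f (Suc n) w = u"
proof -
  interpret A: Module.module R "fm (q n)" by (rule fm_module)
  interpret B: Module.module R "fm (q (Suc n))" by (rule fm_module)
  note dP = resolution_diff[OF P] and dQ = resolution_diff[OF Q]
  have fw: "f (Suc n) w \<in> carrier (fm (q (Suc n)))" by (rule lin_closed[OF f w])
  have "dQ n (u \<ominus>\<^bsub>fm (q (Suc n))\<^esub> f (Suc n) w) = \<zero>\<^bsub>fm (q n)\<^esub>"
    using lin_minus[OF fm_module fm_module dQ u fw] fd[OF w] z lin_closed[OF f lin_closed[OF dP w]]
    by simp
  then have "u \<ominus>\<^bsub>fm (q (Suc n))\<^esub> f (Suc n) w \<in> dQ (Suc n) ` carrier (fm (q (Suc (Suc n))))"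
    unfolding resolution_exact_Suc[OF Q] using u fw by simp
  then obtain u' where u': "u' \<in> carrier (fm (q (Suc (Suc n))))"
    "dQ (Suc n) u' = u \<ominus>\<^bsub>fm (q (Suc n))\<^esub> f (Suc n) w" by force
  have "dQ (Suc n) u' \<oplus>\<^bsub>fm (q (Suc n))\<^esub> f (Suc n) w = u"
    using u fw by (simp add: u'(2) a_minus_def B.a_assoc B.l_neg)
  then show ?thesis using u'(1) by blast
qed

text \<open>
  If \<open>w = - d w'\<close>, then \<open>u - f w'\<close> is a cycle of \<open>Q\<close>, hence a boundary \<open>d u'\<close>, and
  \<open>(u', w')\<close> maps to \<open>(u, w)\<close>.
\<close>

lemma cone_exact_step:
  assumes u: "u \<in> carrier (fm (q (Suc n)))" and w: "w \<in> carrier (fm (p n))"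
    and z: "dQ n u \<oplus>\<^bsub>fm (q n)\<^esub> f n w = \<zero>\<^bsub>fm (q n)\<^esub>"
    and w_im: "w \<in> dP n ` carrier (fm (p (Suc n)))"
  shows "vec_pair (q (Suc n)) (p n) u w \<in> cone_diff (Suc n) ` carrier (fm (cone_rank (Suc (Suc n))))"
proof -
  interpret A: Module.module R "fm (q n)" by (rule fm_module)
  interpret B: Module.module R "fm (p n)" by (rule fm_module)
  interpret C: Module.module R "fm (p (Suc n))" by (rule fm_module)
  note dP = resolution_diff[OF P] and dQ = resolution_diff[OF Q]
  obtain w' where w': "w' \<in> carrier (fm (p (Suc n)))" "dP n w' = w" using w_im by blast
  define w2 where "w2 = \<ominus>\<^bsub>fm (p (Suc n))\<^esub> w'"
  have w2: "w2 \<in> carrier (fm (p (Suc n)))" "dP n w2 = \<ominus>\<^bsub>fm (p n)\<^esub> w"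
    using w' lin_neg[OF fm_module fm_module dP w'(1)] by (simp_all add: w2_def)
  have fw: "f n w \<in> carrier (fm (q n))" and du: "dQ n u \<in> carrier (fm (q n))"
    using lin_closed[OF f w] lin_closed[OF dQ u] .
  have "dQ n u = \<ominus>\<^bsub>fm (q n)\<^esub> f n w" using A.M.minus_equality[OF z fw du] by simp
  then have "dQ n u = f n (dP n w2)" using w2(2) lin_neg[OF fm_module fm_module f w] by simp
  from cone_top_preimage[OF u w2(1) this]
  obtain u' where u': "u' \<in> carrier (fm (q (Suc (Suc n))))"
    "dQ (Suc n) u' \<oplus>\<^bsub>fm (q (Suc n))\<^esub> f (Suc n) w2 = u" by blast
  have "cone_diff (Suc n) (vec_pair (q (Suc (Suc n))) (p (Suc n)) u' w2) = vec_pair (q (Suc n)) (p n) u w"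
    using cone_diff_pair[OF u'(1) w2(1)] u'(2) w2(2) w by simp
  moreover have "vec_pair (q (Suc (Suc n))) (p (Suc n)) u' w2 \<in> carrier (fm (cone_rank (Suc (Suc n))))"
    using vec_pair_closed[OF u'(1) w2(1)] by (simp add: cone_rank_simps)
  ultimately show ?thesis by (metis imageI)
qed

text \<open>
  Exactness in positive degrees reduces to \<open>cone_exact_step\<close>, for which the component in \<open>P\<close>
  of a cycle has to be a boundary. Above degree \<open>1\<close> this component is a cycle of \<open>P\<close>. In degree
  \<open>1\<close> its image in \<open>N\<close> goes to zero under \<open>\<iota>\<close>, and \<open>\<iota>\<close> is injective.
\<close>

theorem cone_resolution:
  assumes M: "Module.module R M" and g: "g \<in> lin R F M" and onto: "g ` carrier F = carrier M"
    and ker: "\<And>v. v \<in> carrier F \<Longrightarrow> g v = \<zero>\<^bsub>M\<^esub> \<longleftrightarrow> v \<in> \<iota> ` carrier N"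
    and inj: "\<And>v. v \<in> carrier N \<Longrightarrow> \<iota> v = \<zero>\<^bsub>F\<^esub> \<Longrightarrow> v = \<zero>\<^bsub>N\<^esub>"
  shows "free_resolution R M cone_rank cone_diff (\<lambda>v. g (\<epsilon>Q v))"
proof -
  interpret M: Module.module R M by fact
  interpret F: Module.module R F by (rule F)
  note dP = resolution_diff[OF P] and dQ = resolution_diff[OF Q]
  note \<epsilon>P = resolution_aug[OF P] and \<epsilon>Q = resolution_aug[OF Q]
  have dec: "\<exists>u w. u \<in> carrier (fm (q (Suc n))) \<and> w \<in> carrier (fm (p n)) \<and>
      v = vec_pair (q (Suc n)) (p n) u w" if "v \<in> carrier (fm (cone_rank (Suc n)))" for n v
    using that vec_pair_split[of v "q (Suc n)" "p n"] lin_closed[OF vec_fst_lin, of v]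
      lin_closed[OF vec_snd_lin, of v] unfolding cone_rank_simps by metis
  have aug: "(\<lambda>v. g (\<epsilon>Q v)) \<in> lin R (fm (cone_rank 0)) M"
    using lin_comp[OF \<epsilon>Q g] by (simp add: cone_rank_simps)
  have aug_onto: "(\<lambda>v. g (\<epsilon>Q v)) ` carrier (fm (cone_rank 0)) = carrier M"
    using onto resolution_aug_onto[OF Q] by (simp add: cone_rank_simps image_image[symmetric])
  have aug0: "\<epsilon>Q (dQ 0 u \<oplus>\<^bsub>fm (q 0)\<^esub> f 0 w) = \<iota> (\<epsilon>P w)"
    if "u \<in> carrier (fm (q (Suc 0)))" "w \<in> carrier (fm (p 0))" for u w
  proof -
    have "\<epsilon>Q (dQ 0 u \<oplus>\<^bsub>fm (q 0)\<^esub> f 0 w) = \<epsilon>Q (dQ 0 u) \<oplus>\<^bsub>F\<^esub> \<epsilon>Q (f 0 w)"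
      using that by (intro LinearCombinations.module_hom_add[OF \<epsilon>Q] lin_closed[OF dQ] lin_closed[OF f])
    then show ?thesis
      using resolution_comp_0[OF Q that(1)] f0[OF that(2)]
        lin_closed[OF \<iota> lin_closed[OF \<epsilon>P that(2)]] by simp
  qed
  have ex0: "cone_diff 0 ` carrier (fm (cone_rank (Suc 0)))
      = a_kernel (fm (cone_rank 0)) M (\<lambda>v. g (\<epsilon>Q v))"
  proof (intro equalityI subsetI)
    fix y assume "y \<in> cone_diff 0 ` carrier (fm (cone_rank (Suc 0)))"
    then obtain v where v: "v \<in> carrier (fm (cone_rank (Suc 0)))" "y = cone_diff 0 v" by blast
    obtain u w where uw: "u \<in> carrier (fm (q (Suc 0)))" "w \<in> carrier (fm (p 0))"
      "v = vec_pair (q (Suc 0)) (p 0) u w" using dec[OF v(1)] by blast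
    have "\<epsilon>Q y = \<iota> (\<epsilon>P w)"
      using aug0[OF uw(1,2)] cone_top_pair[OF uw(1,2)] v(2) uw(3) by (simp add: cone_diff_simps)
    moreover have "\<iota> (\<epsilon>P w) \<in> carrier F" "\<iota> (\<epsilon>P w) \<in> \<iota> ` carrier N"
      using lin_closed[OF \<epsilon>P uw(2)] lin_closed[OF \<iota>] by auto
    ultimately have "g (\<epsilon>Q y) = \<zero>\<^bsub>M\<^esub>" using ker by simp
    then show "y \<in> a_kernel (fm (cone_rank 0)) M (\<lambda>v. g (\<epsilon>Q v))"
      using lin_closed[OF cone_diff_lin v(1)] v(2) by (simp add: a_kernel_def')
  next
    fix v assume "v \<in> a_kernel (fm (cone_rank 0)) M (\<lambda>v. g (\<epsilon>Q v))"
    then have v: "v \<in> carrier (fm (q 0))" "g (\<epsilon>Q v) = \<zero>\<^bsub>M\<^esub>"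
      by (simp_all add: a_kernel_def' cone_rank_simps)
    then obtain x where x: "x \<in> carrier N" "\<epsilon>Q v = \<iota> x" using ker[OF lin_closed[OF \<epsilon>Q v(1)]] by blast
    then obtain w where w: "w \<in> carrier (fm (p 0))" "x = \<epsilon>P w"
      using resolution_aug_onto[OF P] by (metis imageE)
    interpret A: Module.module R "fm (q 0)" by (rule fm_module)
    have fw: "f 0 w \<in> carrier (fm (q 0))" by (rule lin_closed[OF f w(1)])
    have "\<epsilon>Q (v \<ominus>\<^bsub>fm (q 0)\<^esub> f 0 w) = \<zero>\<^bsub>F\<^esub>"
      using lin_minus[OF fm_module F \<epsilon>Q v(1) fw] f0[OF w(1)] x w(2) lin_closed[OF \<iota> x(1)] by simp
    then have "v \<ominus>\<^bsub>fm (q 0)\<^esub> f 0 w \<in> dQ 0 ` carrier (fm (q (Suc 0)))"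
      unfolding resolution_exact_0[OF Q] using v fw by simp
    then obtain u where u: "u \<in> carrier (fm (q (Suc 0)))" "dQ 0 u = v \<ominus>\<^bsub>fm (q 0)\<^esub> f 0 w" by force
    have "cone_diff 0 (vec_pair (q (Suc 0)) (p 0) u w) = v"
      using cone_top_pair[OF u(1) w(1)] u(2) v(1) fw
      by (simp add: cone_diff_simps a_minus_def A.a_assoc A.l_neg)
    moreover have "vec_pair (q (Suc 0)) (p 0) u w \<in> carrier (fm (cone_rank (Suc 0)))"
      using vec_pair_closed[OF u(1) w(1)] by (simp add: cone_rank_simps)
    ultimately show "v \<in> cone_diff 0 ` carrier (fm (cone_rank (Suc 0)))" by (metis imageI)
  qed
  have comp: "cone_diff n (cone_diff (Suc n) v) = \<zero>\<^bsub>fm (cone_rank n)\<^esub>"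
    if v: "v \<in> carrier (fm (cone_rank (Suc (Suc n))))" for n v
  proof -
    obtain u w where uw: "u \<in> carrier (fm (q (Suc (Suc n))))" "w \<in> carrier (fm (p (Suc n)))"
      "v = vec_pair (q (Suc (Suc n))) (p (Suc n)) u w" using dec[OF v] by blast
    interpret A: Module.module R "fm (q (Suc n))" by (rule fm_module)
    interpret B: Module.module R "fm (p n)" by (rule fm_module)
    let ?u = "dQ (Suc n) u \<oplus>\<^bsub>fm (q (Suc n))\<^esub> f (Suc n) w" and ?w = "\<ominus>\<^bsub>fm (p n)\<^esub> dP n w"
    have u': "?u \<in> carrier (fm (q (Suc n)))" and w': "?w \<in> carrier (fm (p n))"
      using lin_closed[OF dQ uw(1)] lin_closed[OF f uw(2)] lin_closed[OF dP uw(2)] by simp_all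
    have eq: "cone_diff (Suc n) v = vec_pair (q (Suc n)) (p n) ?u ?w"
      unfolding uw(3) by (rule cone_diff_pair[OF uw(1,2)])
    have top: "cone_top n (vec_pair (q (Suc n)) (p n) ?u ?w) = \<zero>\<^bsub>fm (q n)\<^esub>"
      using cone_top_pair[OF u' w'] cone_top_top[OF uw(1,2)] by simp
    show ?thesis
    proof (cases n)
      case 0
      then show ?thesis using eq top by (simp add: cone_diff_simps cone_rank_simps)
    next
      case (Suc m)
      interpret D: Module.module R "fm (p m)" by (rule fm_module)
      have "dP m ?w = \<ominus>\<^bsub>fm (p m)\<^esub> dP m (dP n w)"
        unfolding Suc by (rule lin_neg[OF fm_module fm_module dP lin_closed[OF dP]]) (use uw Suc in simp)
      also have "dP m (dP n w) = \<zero>\<^bsub>fm (p m)\<^esub>"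
        unfolding Suc by (rule resolution_comp_Suc[OF P]) (use uw Suc in simp)
      finally have dw: "\<ominus>\<^bsub>fm (p m)\<^esub> dP m ?w = \<zero>\<^bsub>fm (p m)\<^esub>" by simp
      have "cone_diff n (vec_pair (q (Suc n)) (p n) ?u ?w)
          = vec_pair (q n) (p m) (cone_top n (vec_pair (q (Suc n)) (p n) ?u ?w))
             (\<ominus>\<^bsub>fm (p m)\<^esub> dP m (vec_snd (q (Suc n)) (p n) (vec_pair (q (Suc n)) (p n) ?u ?w)))"
        by (simp add: Suc cone_diff_simps)
      also have "\<dots> = vec_pair (q n) (p m) \<zero>\<^bsub>fm (q n)\<^esub> \<zero>\<^bsub>fm (p m)\<^esub>"
        using top dw by (simp add: vec_snd_pair[OF w'])
      also have "\<dots> = \<zero>\<^bsub>fm (cone_rank n)\<^esub>" by (simp add: vec_pair_zero Suc cone_rank_simps)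
      finally show ?thesis by (simp add: eq)
    qed
  qed
  have ex: "cone_diff (Suc n) ` carrier (fm (cone_rank (Suc (Suc n))))
      = a_kernel (fm (cone_rank (Suc n))) (fm (cone_rank n)) (cone_diff n)" for n
  proof (intro equalityI subsetI)
    fix y assume "y \<in> cone_diff (Suc n) ` carrier (fm (cone_rank (Suc (Suc n))))"
    then show "y \<in> a_kernel (fm (cone_rank (Suc n))) (fm (cone_rank n)) (cone_diff n)"
      using comp lin_closed[OF cone_diff_lin] by (auto simp: a_kernel_def')
  next
    fix v assume "v \<in> a_kernel (fm (cone_rank (Suc n))) (fm (cone_rank n)) (cone_diff n)"
    then have v: "v \<in> carrier (fm (cone_rank (Suc n)))" "cone_diff n v = \<zero>\<^bsub>fm (cone_rank n)\<^esub>"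
      by (simp_all add: a_kernel_def')
    obtain u w where uw: "u \<in> carrier (fm (q (Suc n)))" "w \<in> carrier (fm (p n))"
      "v = vec_pair (q (Suc n)) (p n) u w" using dec[OF v(1)] by blast
    have "dQ n u \<oplus>\<^bsub>fm (q n)\<^esub> f n w = \<zero>\<^bsub>fm (q n)\<^esub> \<and> w \<in> dP n ` carrier (fm (p (Suc n)))"
    proof (cases n)
      case 0
      have z: "dQ 0 u \<oplus>\<^bsub>fm (q 0)\<^esub> f 0 w = \<zero>\<^bsub>fm (q 0)\<^esub>"
        using v(2) uw cone_top_pair[of u 0 w] 0 by (simp add: cone_diff_simps cone_rank_simps)
      have "\<iota> (\<epsilon>P w) = \<zero>\<^bsub>F\<^esub>"
        using aug0[of u w] uw 0 z lin_zero[OF fm_module F \<epsilon>Q] by simp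
      then have "\<epsilon>P w = \<zero>\<^bsub>N\<^esub>" using inj lin_closed[OF \<epsilon>P, of w] uw 0 by simp
      then have "w \<in> dP 0 ` carrier (fm (p (Suc 0)))"
        unfolding resolution_exact_0[OF P] using uw 0 by simp
      then show ?thesis using z 0 by simp
    next
      case (Suc m)
      interpret D: Module.module R "fm (p m)" by (rule fm_module)
      interpret E: Module.module R "fm (q n)" by (rule fm_module)
      let ?a = "dQ n u \<oplus>\<^bsub>fm (q n)\<^esub> f n w" and ?b = "\<ominus>\<^bsub>fm (p m)\<^esub> dP m w"
      have a: "?a \<in> carrier (fm (q n))" using lin_closed[OF dQ uw(1)] lin_closed[OF f uw(2)] by simp
      have w': "w \<in> carrier (fm (p (Suc m)))" using uw Suc by simp
      have b: "?b \<in> carrier (fm (p m))" using lin_closed[OF dP w'] by simp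
      have "vec_pair (q n) (p m) ?a ?b = vec_pair (q n) (p m) \<zero>\<^bsub>fm (q n)\<^esub> \<zero>\<^bsub>fm (p m)\<^esub>"
        using v(2) cone_diff_pair[of u m w] uw Suc by (simp add: vec_pair_zero cone_rank_simps)
      then have "?a = \<zero>\<^bsub>fm (q n)\<^esub>" "?b = \<zero>\<^bsub>fm (p m)\<^esub>"
        using vec_fst_pair[OF a] vec_snd_pair[OF b] vec_fst_pair[OF E.M.zero_closed]
          vec_snd_pair[OF D.M.zero_closed] by metis+
      then have "dP m w = \<zero>\<^bsub>fm (p m)\<^esub>" 
        using D.M.r_neg[OF lin_closed[OF dP w']] D.M.r_zero[OF lin_closed[OF dP w']] by simp
      then have "w \<in> dP (Suc m) ` carrier (fm (p (Suc (Suc m))))"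
        unfolding resolution_exact_Suc[OF P] using w' by simp
      then show ?thesis using \<open>?a = \<zero>\<^bsub>fm (q n)\<^esub>\<close> Suc by simp
    qed
    then show "v \<in> cone_diff (Suc n) ` carrier (fm (cone_rank (Suc (Suc n))))"
      using cone_exact_step[OF uw(1,2)] uw(3) by simp
  qed
  show ?thesis
    unfolding free_resolution_def using aug aug_onto cone_diff_lin ex0 ex by simp
qed

end

locale local_resolution_map = resolution_map + noetherian_local_ring R
begin

text \<open>
  If \<open>P\<close> is minimal, a vector \<open>(0, w)\<close> of the cone is a cycle modulo \<open>\<mm>\<close> as soon as \<open>f w\<close>
  vanishes modulo \<open>\<mm>\<close>, whereas the \<open>P\<close>-component of every boundary vanishes modulo \<open>\<mm>\<close>.
  By \<open>tor_injective\<close>, no \<open>w\<close> that is nonzero modulo \<open>\<mm>\<close> can therefore vanish modulo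
  \<open>\<mm>\<close> both under \<open>f\<close> and under the comparison map into the resolution with ranks \<open>t\<close>.
  Counting equations gives the first bound. If \<open>f 0\<close> vanishes modulo \<open>\<mm>\<close>, its equations drop
  out for \<open>n = 0\<close>; if moreover \<open>dQ 0\<close> does, then so do all boundaries of the cone in degree
  \<open>0\<close>, and the same count bounds \<open>q 0\<close>.
\<close>

lemma cone_ranks:
  assumes M: "Module.module R M" and C: "free_resolution R M cone_rank cone_diff \<epsilon>C"
    and T: "free_resolution R M t dT \<epsilon>T"
    and Pmin: "\<And>n v. v \<in> carrier (fm (p (Suc n))) \<Longrightarrow> dP n v \<in> fm_ideal mm (p n)"
  shows "p n \<le> t (Suc n) + q n"
    and "(\<And>w. w \<in> carrier (fm (p 0)) \<Longrightarrow> f 0 w \<in> fm_ideal mm (q 0)) \<Longrightarrow> p 0 \<le> t (Suc 0)"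
    and "(\<And>w. w \<in> carrier (fm (p 0)) \<Longrightarrow> f 0 w \<in> fm_ideal mm (q 0)) \<Longrightarrow>
         (\<And>u. u \<in> carrier (fm (q (Suc 0))) \<Longrightarrow> dQ 0 u \<in> fm_ideal mm (q 0)) \<Longrightarrow> q 0 \<le> t 0"
proof -
  note dP = resolution_diff[OF P] and dQ = resolution_diff[OF Q]
  have zero_lin: "(\<lambda>_. \<zero>\<^bsub>fm k\<^esub>) \<in> lin R (fm l) (fm k)" for k l
    by (rule lin_zero_map[OF fm_module])
  have id_lin: "(\<lambda>v. v) \<in> lin R (fm k) (fm k)" for k by (rule linI) simp_all
  have in_lin: "(\<lambda>w. vec_pair (q (Suc n)) (p n) \<zero>\<^bsub>fm (q (Suc n))\<^esub> w)
      \<in> lin R (fm (p n)) (fm (cone_rank (Suc n)))" for n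
    unfolding cone_rank_simps by (rule vec_pair_lin[OF fm_module zero_lin id_lin])
  obtain \<alpha> where \<alpha>_lin: "\<And>n. \<alpha> n \<in> lin R (fm (cone_rank n)) (fm (t n))"
    and \<alpha>: "\<forall>n v. v \<in> carrier (fm (cone_rank n)) \<longrightarrow> \<alpha> n v \<in> fm_ideal mm (t n) \<longrightarrow>
         (\<forall>m. n = Suc m \<longrightarrow> cone_diff m v \<in> fm_ideal mm (cone_rank m)) \<longrightarrow>
         (\<exists>w \<in> carrier (fm (cone_rank (Suc n))). v \<ominus>\<^bsub>fm (cone_rank n)\<^esub> cone_diff n w \<in> fm_ideal mm (cone_rank n))"
  proof (rule tor_injective[OF C T M max_ideal_ideal])
    fix \<alpha>
    assume 1: "\<And>n. \<alpha> n \<in> lin R (fm (cone_rank n)) (fm (t n))"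
      and 2: "\<And>n v. v \<in> carrier (fm (cone_rank n)) \<Longrightarrow> \<alpha> n v \<in> fm_ideal mm (t n) \<Longrightarrow>
         (\<forall>m. n = Suc m \<longrightarrow> cone_diff m v \<in> fm_ideal mm (cone_rank m)) \<Longrightarrow>
         \<exists>w \<in> carrier (fm (cone_rank (Suc n))). v \<ominus>\<^bsub>fm (cone_rank n)\<^esub> cone_diff n w \<in> fm_ideal mm (cone_rank n)"
    show thesis by (rule that[OF 1]) (use 2 in simp_all)
  qed
  have key: "w \<in> fm_ideal mm (p n)"
    if w: "w \<in> carrier (fm (p n))" and fw: "f n w \<in> fm_ideal mm (q n)"
      and aw: "\<alpha> (Suc n) (vec_pair (q (Suc n)) (p n) \<zero>\<^bsub>fm (q (Suc n))\<^esub> w) \<in> fm_ideal mm (t (Suc n))"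
    for n w
  proof -
    interpret A: Module.module R "fm (q n)" by (rule fm_module)
    interpret B: Module.module R "fm (p n)" by (rule fm_module)
    interpret D: Module.module R "fm (q (Suc n))" by (rule fm_module)
    let ?v = "vec_pair (q (Suc n)) (p n) \<zero>\<^bsub>fm (q (Suc n))\<^esub> w"
    have v: "?v \<in> carrier (fm (cone_rank (Suc n)))" by (rule lin_closed[OF in_lin w])
    have "cone_top n ?v = f n w"
      using cone_top_pair[OF D.M.zero_closed w] lin_zero[OF fm_module fm_module dQ] lin_closed[OF f w]
      by simp
    then have top: "cone_top n ?v \<in> fm_ideal mm (q n)" using fw by simp
    have neg: "\<ominus>\<^bsub>fm k\<^esub> u \<in> fm_ideal mm k" if "u \<in> fm_ideal mm k" for k u
    proof -
      interpret E: Module.module R "fm k" by (rule fm_module)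
      have "\<zero>\<^bsub>fm k\<^esub> \<in> fm_ideal mm k"
        using additive_subgroup.zero_closed[OF ideal.axioms(1)[OF max_ideal_ideal]]
        by (simp add: fm_ideal_def fm_zero)
      from fm_ideal_minus[OF max_ideal_ideal this that]
      show ?thesis using fm_ideal_carrier[OF that] by (simp add: a_minus_def)
    qed
    have dv: "cone_diff n ?v \<in> fm_ideal mm (cone_rank n)"
    proof (cases n)
      case 0
      then show ?thesis using top by (simp add: cone_diff_simps cone_rank_simps)
    next
      case (Suc m)
      have "cone_diff n ?v = vec_pair (q n) (p m) (cone_top n ?v) (\<ominus>\<^bsub>fm (p m)\<^esub> dP m w)"
        using w Suc by (simp add: cone_diff_simps vec_snd_pair)
      moreover have "dP m w \<in> fm_ideal mm (p m)" using Pmin[of w m] w Suc by simp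
      ultimately show ?thesis
        using vec_pair_fm_ideal[OF top neg] Suc by (simp add: cone_rank_simps)
    qed
    have "\<exists>z \<in> carrier (fm (cone_rank (Suc (Suc n)))).
        ?v \<ominus>\<^bsub>fm (cone_rank (Suc n))\<^esub> cone_diff (Suc n) z \<in> fm_ideal mm (cone_rank (Suc n))"
      using \<alpha>[rule_format, OF v aw] dv by simp
    then obtain z where z: "z \<in> carrier (fm (cone_rank (Suc (Suc n))))"
      and vz: "?v \<ominus>\<^bsub>fm (cone_rank (Suc n))\<^esub> cone_diff (Suc n) z \<in> fm_ideal mm (cone_rank (Suc n))" ..
    let ?s = "vec_snd (q (Suc n)) (p n)"
    define z2 where "z2 = vec_snd (q (Suc (Suc n))) (p (Suc n)) z"
    have z2: "z2 \<in> carrier (fm (p (Suc n)))"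
      using lin_closed[OF vec_snd_lin, of z "q (Suc (Suc n))" "p (Suc n)"] z
      by (simp add: z2_def cone_rank_simps)
    have dz: "cone_diff (Suc n) z \<in> carrier (fm (q (Suc n) + p n))"
      using lin_closed[OF cone_diff_lin z] by (simp add: cone_rank_simps)
    have "?s (?v \<ominus>\<^bsub>fm (cone_rank (Suc n))\<^esub> cone_diff (Suc n) z)
        = ?s ?v \<ominus>\<^bsub>fm (p n)\<^esub> ?s (cone_diff (Suc n) z)"
      unfolding cone_rank_simps
      by (rule lin_minus[OF fm_module fm_module vec_snd_lin _ dz]) (use v in \<open>simp add: cone_rank_simps\<close>)
    also have "?s ?v = w" by (rule vec_snd_pair[OF w])
    also have "?s (cone_diff (Suc n) z) = \<ominus>\<^bsub>fm (p n)\<^esub> dP n z2"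
      using lin_closed[OF dP z2] by (simp add: cone_diff_simps vec_snd_pair z2_def)
    finally have "w \<ominus>\<^bsub>fm (p n)\<^esub> (\<ominus>\<^bsub>fm (p n)\<^esub> dP n z2) \<in> fm_ideal mm (p n)"
      using vec_snd_fm_ideal[OF max_ideal_ideal vz[unfolded cone_rank_simps]]
      by (simp add: cone_rank_simps)
    then show ?thesis by (rule fm_ideal_minus_cancel[OF max_ideal_ideal w neg[OF Pmin[OF z2]]])
  qed
  show "p n \<le> t (Suc n) + q n"
  proof (rule ccontr)
    assume "\<not> p n \<le> t (Suc n) + q n"
    then have "t (Suc n) + q n < p n" by simp
    from lin_comp[OF in_lin \<alpha>_lin] f this show False
      by (rule underdetermined) (use key in blast)
  qed
  show "p 0 \<le> t (Suc 0)" if f0: "\<And>w. w \<in> carrier (fm (p 0)) \<Longrightarrow> f 0 w \<in> fm_ideal mm (q 0)"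
  proof (rule ccontr)
    assume "\<not> p 0 \<le> t (Suc 0)"
    then have "t (Suc 0) + 0 < p 0" by simp
    from lin_comp[OF in_lin \<alpha>_lin] zero_lin this show False
      by (rule underdetermined) (use key f0 in blast)
  qed
  show "q 0 \<le> t 0"
    if f0: "\<And>w. w \<in> carrier (fm (p 0)) \<Longrightarrow> f 0 w \<in> fm_ideal mm (q 0)"
      and dQ0: "\<And>u. u \<in> carrier (fm (q (Suc 0))) \<Longrightarrow> dQ 0 u \<in> fm_ideal mm (q 0)"
  proof (rule ccontr)
    assume "\<not> q 0 \<le> t 0"
    then have less: "t 0 + 0 < q 0" by simp
    have "\<alpha> 0 \<in> lin R (fm (q 0)) (fm (t 0))" using \<alpha>_lin[of 0] by (simp add: cone_rank_simps)
    from this zero_lin less obtain v where v: "v \<in> carrier (fm (q 0))" "v \<notin> fm_ideal mm (q 0)"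
      "\<alpha> 0 v \<in> fm_ideal mm (t 0)" "\<zero>\<^bsub>fm 0\<^esub> \<in> fm_ideal mm 0"
      by (rule underdetermined)
    then have "\<exists>z \<in> carrier (fm (cone_rank (Suc 0))).
        v \<ominus>\<^bsub>fm (q 0)\<^esub> cone_diff 0 z \<in> fm_ideal mm (q 0)"
      using \<alpha>[rule_format, of v 0] by (simp add: cone_rank_simps)
    then obtain z where z: "z \<in> carrier (fm (cone_rank (Suc 0)))"
      and vz: "v \<ominus>\<^bsub>fm (q 0)\<^esub> cone_diff 0 z \<in> fm_ideal mm (q 0)" ..
    have "cone_diff 0 z \<in> fm_ideal mm (q 0)"
      unfolding cone_diff_simps cone_top_def
      using z lin_closed[OF vec_fst_lin, of z "q (Suc 0)" "p 0"] lin_closed[OF vec_snd_lin, of z "q (Suc 0)" "p 0"]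
      by (intro fm_ideal_add[OF max_ideal_ideal] dQ0 f0) (simp_all add: cone_rank_simps)
    from fm_ideal_minus_cancel[OF max_ideal_ideal v(1) this vz] v(2) show False by blast
  qed
qed

end

section \<open>Residue rings and restriction of scalars\<close>

text \<open>
  Ideals of the quotient pull back to ideals of \<open>R\<close>, so generators descend; units map to units,
  so the image of the maximal ideal satisfies \<open>local_ring_criterion\<close>.
\<close>

lemma (in noetherian_local_ring) quotient_local:
  assumes I: "ideal I R" "I \<subseteq> mm"
  shows "noetherian_local_ring (R Quot I)"
    and "s \<in> carrier R \<Longrightarrow> I +> s \<in> max_ideal (R Quot I) \<Longrightarrow> s \<in> mm"
proof -
  interpret I: ideal I R by fact
  let ?Q = "R Quot I"
  interpret Q: cring ?Q by (rule I.quotient_is_cring[OF is_cring])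
  interpret \<pi>: ring_hom_ring R ?Q "(+>) I" by (rule I.rcos_ring_hom_ring)
  have surj: "\<exists>r \<in> carrier R. c = I +> r" if "c \<in> carrier ?Q" for c
    using that unfolding FactRing_def by (simp add: A_RCOSETS_def')
  have noeth: "noetherian_ring ?Q"
  proof (rule Q.noetherian_ringI)
    fix J assume J: "ideal J ?Q"
    obtain B where B: "B \<subseteq> carrier R" "finite B" "{r \<in> carrier R. I +> r \<in> J} = Idl B"
      using finetely_gen[OF \<pi>.ideal_vimage[OF J]] by blast
    let ?B = "(+>) I ` B"
    have BQ: "?B \<subseteq> carrier ?Q" using B(1) by auto
    have BJ: "?B \<subseteq> J" using genideal_self[OF B(1)] B(3) by blast
    have "Idl B \<subseteq> {r \<in> carrier R. I +> r \<in> Idl\<^bsub>?Q\<^esub> ?B}"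
      using genideal_minimal[OF \<pi>.ideal_vimage[OF Q.genideal_ideal[OF BQ]]] Q.genideal_self[OF BQ] B(1)
      by blast
    then have "J \<subseteq> Idl\<^bsub>?Q\<^esub> ?B"
      using surj ideal.Icarr[OF J] B(3) by blast
    then have "J = Idl\<^bsub>?Q\<^esub> ?B" using Q.genideal_minimal[OF J BJ] by blast
    then show "\<exists>A \<subseteq> carrier ?Q. finite A \<and> J = Idl\<^bsub>?Q\<^esub> A" using BQ B(2) by blast
  qed
  let ?m = "(+>) I ` mm"
  have mem: "s \<in> mm" if s: "s \<in> carrier R" "I +> s \<in> ?m" for s
  proof -
    obtain m where m: "m \<in> mm" "I +> s = I +> m" using s(2) by blast
    have mc: "m \<in> carrier R" using ideal.Icarr[OF max_ideal_ideal m(1)] .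
    then have "s \<ominus> m \<in> mm" using quotient_eq_iff_same_a_r_cos[OF I(1) s(1) mc] m(2) I(2) by blast
    then have "(s \<ominus> m) \<oplus> m \<in> mm"
      using additive_subgroup.a_closed[OF ideal.axioms(1)[OF max_ideal_ideal]] m(1) by blast
    then show ?thesis using s(1) mc by (simp add: a_minus_def a_assoc l_neg)
  qed
  have mi: "ideal ?m ?Q" by (rule ring_ideal_imp_quot_ideal[OF I(1) max_ideal_ideal])
  have m1: "\<one>\<^bsub>?Q\<^esub> \<notin> ?m" using mem[OF one_closed] max_ideal_proper \<pi>.hom_one by auto
  have units: "c \<in> Units ?Q" if c: "c \<in> carrier ?Q" "c \<notin> ?m" for c
  proof -
    obtain s where s: "s \<in> carrier R" "c = I +> s" using surj[OF c(1)] by blast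
    then have u: "s \<in> Units R" using outside_max_ideal_unit c(2) by blast
    have ic: "I +> inv s \<in> carrier ?Q" using u by simp
    have "c \<otimes>\<^bsub>?Q\<^esub> (I +> inv s) = \<one>\<^bsub>?Q\<^esub>"
      using s(2) \<pi>.hom_mult[of s "inv s"] \<pi>.hom_one s(1) u by simp
    moreover from this have "(I +> inv s) \<otimes>\<^bsub>?Q\<^esub> c = \<one>\<^bsub>?Q\<^esub>" using Q.m_comm[OF c(1) ic] by simp
    ultimately show ?thesis using c(1) ic unfolding Units_def by blast
  qed
  show "noetherian_local_ring ?Q" by (rule Q.local_ring_criterion(1)[OF noeth mi m1 units])
  show "s \<in> mm" if "s \<in> carrier R" "I +> s \<in> max_ideal ?Q"
    using mem[OF that(1)] that(2) Q.local_ring_criterion(2)[OF noeth mi m1 units] by simp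
qed

lemma restrict_scalars_simps:
  "carrier (restrict_scalars h X) = carrier X" "zero (restrict_scalars h X) = zero X"
  "add (restrict_scalars h X) = add X" "smult (restrict_scalars h X) = (\<lambda>a v. h a \<odot>\<^bsub>X\<^esub> v)"
  by (simp_all add: restrict_scalars_def)

lemma restrict_scalars_module:
  assumes A: "cring A" and h: "h \<in> ring_hom A B" and X: "Module.module B X"
  shows "Module.module A (restrict_scalars h X)"
proof -
  interpret A: cring A by fact
  interpret X: Module.module B X by fact
  note hc = ring_hom_closed[OF h]
  have "abelian_group (restrict_scalars h X)"
  proof (rule abelian_groupI, unfold restrict_scalars_simps)
    fix v assume "v \<in> carrier X"
    then show "\<exists>w\<in>carrier X. w \<oplus>\<^bsub>X\<^esub> v = \<zero>\<^bsub>X\<^esub>"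
      by (intro bexI[of _ "\<ominus>\<^bsub>X\<^esub> v"]) (simp_all add: X.M.l_neg)
  qed (simp_all add: X.M.a_ac)
  then show ?thesis
    by (intro moduleI[OF A], unfold restrict_scalars_simps)
       (simp_all add: hc ring_hom_add[OF h] ring_hom_mult[OF h] ring_hom_one[OF h]
          X.smult_l_distr X.smult_r_distr X.smult_assoc1)
qed

lemma lin_restrict_scalars:
  assumes "h \<in> ring_hom A B" "f \<in> lin B X Y"
  shows "f \<in> lin A (restrict_scalars h X) (restrict_scalars h Y)"
  using assms by (auto simp: LinearCombinations.module_hom_def restrict_scalars_simps ring_hom_closed)

text \<open>
  Along a surjection \<open>A \<rightarrow> B\<close> every \<open>A\<close>-submodule of a \<open>B\<close>-module is a \<open>B\<close>-submodule, so
  the same generators work.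
\<close>

lemma finitely_generated_restrict_scalars:
  assumes A: "cring A" and h: "h \<in> ring_hom A B" and surj: "h ` carrier A = carrier B"
    and X: "Module.module B X" and fg: "finitely_generated B X"
  shows "finitely_generated A (restrict_scalars h X)"
proof -
  interpret X: Module.module B X by fact
  interpret Y: Module.module A "restrict_scalars h X" by (rule restrict_scalars_module[OF A h X])
  obtain G where G: "finite G" "G \<subseteq> carrier X" "X.span G = carrier X"
    using fg by (auto simp: finitely_generated_def)
  have GY: "G \<subseteq> carrier (restrict_scalars h X)" using G(2) by (simp add: restrict_scalars_simps)
  interpret K: LinearCombinations.submodule A "Y.span G" "restrict_scalars h X"
    by (rule Y.span_is_submodule[OF GY])
  have "LinearCombinations.submodule B (Y.span G) X"
  proof
    show "Y.span G \<subseteq> carrier X" using K.subset by (simp add: restrict_scalars_simps)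
    show "v \<oplus>\<^bsub>X\<^esub> w \<in> Y.span G" if "v \<in> Y.span G" "w \<in> Y.span G" for v w
      using K.m_closed[OF that] by (simp add: restrict_scalars_simps)
    show "\<zero>\<^bsub>X\<^esub> \<in> Y.span G" using K.zero_closed by (simp add: restrict_scalars_simps)
    show "c \<odot>\<^bsub>X\<^esub> v \<in> Y.span G" if c: "c \<in> carrier B" and v: "v \<in> Y.span G" for c v
    proof -
      obtain a where "a \<in> carrier A" "c = h a" using c surj by blast
      then show ?thesis using K.smult_closed[OF _ v, of a] by (simp add: restrict_scalars_simps)
    qed
  qed
  from X.span_is_subset[OF Y.in_own_span[OF GY] this] G(3) have "carrier X \<subseteq> Y.span G" by simp
  then have "Y.span G = carrier (restrict_scalars h X)"
    using K.subset by (simp add: restrict_scalars_simps)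
  then show ?thesis unfolding finitely_generated_def using G(1) GY by blast
qed

lemma (in cring) finitely_generated_image:
  assumes X: "Module.module R X" and f: "f \<in> lin R (fm n) X" and onto: "f ` carrier (fm n) = carrier X"
  shows "finitely_generated R X"
proof -
  interpret X: Module.module R X by fact
  let ?G = "(\<lambda>i. f (unit_vec n i)) ` {..<n}"
  have G: "?G \<subseteq> carrier X" using lin_closed[OF f unit_vec_closed] by blast
  have sub: "LinearCombinations.submodule R (X.span ?G) X" by (rule X.span_is_submodule[OF G])
  have "f v \<in> X.span ?G" if v: "v \<in> carrier (fm n)" for v
    unfolding lin_expand[OF X f v]
    using X.in_own_span[OF G] fm_coord[OF v]
    by (intro X.finsum_in_submodule[OF sub] LinearCombinations.submodule.smult_closed[OF sub]) auto
  then have "f ` carrier (fm n) \<subseteq> X.span ?G" by (rule image_subsetI)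
  then have "carrier X \<subseteq> X.span ?G" by (simp only: onto)
  then have "X.span ?G = carrier X" using X.span_is_subset2[OF G] by blast
  then show ?thesis unfolding finitely_generated_def using G by blast
qed

section \<open>Change of rings along an exact zero-divisor\<close>

context cring
begin

definition scale :: "'a \<Rightarrow> nat \<Rightarrow> (nat \<Rightarrow> 'a) \<Rightarrow> nat \<Rightarrow> 'a"
  where "scale a n v = (\<lambda>i\<in>{..<n}. a \<otimes> v i)"

lemma scale_closed: "a \<in> carrier R \<Longrightarrow> v \<in> carrier (fm n) \<Longrightarrow> scale a n v \<in> carrier (fm n)"
  unfolding scale_def by (rule fm_memI) (simp add: fm_coord)

lemma scale_lin:
  assumes a: "a \<in> carrier R" shows "scale a n \<in> lin R (fm n) (fm n)"
proof (rule lin_coordwiseI[OF fm_module scale_closed[OF a]])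
  fix v w i assume v: "v \<in> carrier (fm n)" and w: "w \<in> carrier (fm n)" and i: "i < n"
  show "scale a n (v \<oplus>\<^bsub>fm n\<^esub> w) i = scale a n v i \<oplus> scale a n w i"
    using a i fm_coord[OF v i] fm_coord[OF w i] by (simp add: scale_def fm_add r_distr)
next
  fix c v i assume c: "c \<in> carrier R" and v: "v \<in> carrier (fm n)" and i: "i < n"
  show "scale a n (c \<odot>\<^bsub>fm n\<^esub> v) i = c \<otimes> scale a n v i"
    using a i c fm_coord[OF v i] by (simp add: scale_def fm_smult m_lcomm)
qed

lemma scale_image:
  assumes a: "a \<in> carrier R"
  shows "v \<in> scale a n ` carrier (fm n) \<longleftrightarrow> v \<in> carrier (fm n) \<and> (\<forall>i<n. v i \<in> PIdl a)"
proof
  assume "v \<in> scale a n ` carrier (fm n)"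
  then obtain u where u: "u \<in> carrier (fm n)" "v = scale a n u" by blast
  then have "v i \<in> PIdl a" if "i < n" for i
    using that a fm_coord[OF u(1) that] m_comm[of a "u i"] by (auto simp: scale_def cgenideal_def)
  then show "v \<in> carrier (fm n) \<and> (\<forall>i<n. v i \<in> PIdl a)" using u scale_closed[OF a] by simp
next
  assume v: "v \<in> carrier (fm n) \<and> (\<forall>i<n. v i \<in> PIdl a)"
  then have "\<forall>i. \<exists>c. i < n \<longrightarrow> c \<in> carrier R \<and> v i = c \<otimes> a" by (auto simp: cgenideal_def)
  from choice[OF this] obtain c where c: "\<forall>i. i < n \<longrightarrow> c i \<in> carrier R \<and> v i = c i \<otimes> a" ..
  have rc: "restrict c {..<n} \<in> carrier (fm n)" using c by (intro fm_memI) simp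
  have "scale a n (restrict c {..<n}) = v"
  proof (rule fm_eqI)
    show "scale a n (restrict c {..<n}) \<in> carrier (fm n)" by (rule scale_closed[OF a rc])
    show "v \<in> carrier (fm n)" using v by simp
    show "scale a n (restrict c {..<n}) i = v i" if "i < n" for i
      using c that a by (simp add: scale_def m_comm)
  qed
  then show "v \<in> scale a n ` carrier (fm n)" using rc by (metis imageI)
qed

lemma scale_kernel:
  assumes a: "a \<in> carrier R" and v: "v \<in> carrier (fm n)"
  shows "scale a n v = \<zero>\<^bsub>fm n\<^esub> \<longleftrightarrow> (\<forall>i<n. v i \<in> annihilator R a)"
proof -
  interpret F: Module.module R "fm n" by (rule fm_module)
  have "scale a n v = \<zero>\<^bsub>fm n\<^esub> \<longleftrightarrow> (\<forall>i<n. scale a n v i = \<zero>)"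
    using fm_eqI[OF scale_closed[OF a v] F.M.zero_closed] by (auto simp: fm_zero)
  also have "\<dots> \<longleftrightarrow> (\<forall>i<n. v i \<in> annihilator R a)"
    using fm_coord[OF v] a by (auto simp: scale_def annihilator_def m_comm)
  finally show ?thesis .
qed

end

text \<open>
  The partner \<open>y\<close> of the exact zero-divisor \<open>x\<close> is fixed here, since it appears as a
  differential in the periodic resolution.
\<close>

locale exact_pair = noetherian_local_ring R for R (structure) +
  fixes x y
  assumes x_max: "x \<in> max_ideal R" and y_carrier: "y \<in> carrier R"
    and ann_x: "annihilator R x = PIdl y" and ann_y: "annihilator R y = PIdl x"
begin

abbreviation QR :: "'a set ring" where "QR \<equiv> R Quot (PIdl x)"

abbreviation proj :: "'a \<Rightarrow> 'a set" where "proj \<equiv> \<lambda>s. PIdl x +> s"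

abbreviation rs :: "('a set, 'c, 'm) module_scheme \<Rightarrow> ('a, 'c) module"
  where "rs \<equiv> restrict_scalars proj"

lemma x_carrier: "x \<in> carrier R"
  using ideal.Icarr[OF max_ideal_ideal x_max] .

lemma PIdl_x: "ideal (PIdl x) R"
  by (rule cgenideal_ideal[OF x_carrier])

lemma PIdl_x_max: "PIdl x \<subseteq> mm"
  by (rule cgenideal_minimal[OF max_ideal_ideal x_max])

lemma QR_local: "noetherian_local_ring QR"
  by (rule quotient_local(1)[OF PIdl_x PIdl_x_max])

lemma proj_max: "s \<in> carrier R \<Longrightarrow> proj s \<in> max_ideal QR \<Longrightarrow> s \<in> mm"
  by (rule quotient_local(2)[OF PIdl_x PIdl_x_max])

lemma proj_hom: "proj \<in> ring_hom R QR"
  by (rule ideal.rcos_ring_hom[OF PIdl_x])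

lemma proj_onto: "proj ` carrier R = carrier QR"
  unfolding FactRing_def by (auto simp: A_RCOSETS_def')

lemma proj_zero_iff: "s \<in> carrier R \<Longrightarrow> proj s = \<zero>\<^bsub>QR\<^esub> \<longleftrightarrow> s \<in> PIdl x"
  using a_rcos_zero[OF PIdl_x] ideal.rcos_const_imp_mem[OF PIdl_x] by (auto simp: FactRing_def)

lemma rs_module: "Module.module QR X \<Longrightarrow> Module.module R (rs X)"
  by (rule restrict_scalars_module[OF is_cring proj_hom])

lemma rs_fg: "Module.module QR X \<Longrightarrow> finitely_generated QR X \<Longrightarrow> finitely_generated R (rs X)"
  by (rule finitely_generated_restrict_scalars[OF is_cring proj_hom proj_onto])

definition proj_vec :: "nat \<Rightarrow> (nat \<Rightarrow> 'a) \<Rightarrow> nat \<Rightarrow> 'a set"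
  where "proj_vec n v = (\<lambda>i\<in>{..<n}. proj (v i))"

definition periodic_diff :: "nat \<Rightarrow> nat \<Rightarrow> (nat \<Rightarrow> 'a) \<Rightarrow> nat \<Rightarrow> 'a"
  where "periodic_diff n k = scale (if even k then x else y) n"

text \<open>
  Coordinatewise this is \<open>\<dots> \<rightarrow> S \<rightarrow> S \<rightarrow> S \<rightarrow> S/(x)\<close> with maps \<open>x\<close>, \<open>y\<close>, \<open>x\<close>, \<dots>
  from the right, exact because the annihilators of \<open>x\<close> and \<open>y\<close> are generated by the other
  element.
\<close>

lemma periodic_resolution:
  "free_resolution R (rs (free_module QR n)) (\<lambda>_. n) (periodic_diff n) (proj_vec n)"
proof -
  interpret Q: noetherian_local_ring QR by (rule QR_local)
  interpret QF: Module.module QR "Q.fm n" by (rule Q.fm_module)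
  have pc: "proj_vec n v \<in> carrier (Q.fm n)" if "v \<in> carrier (fm n)" for v
    unfolding proj_vec_def using ring_hom_closed[OF proj_hom] fm_coord[OF that] by (intro Q.fm_memI) simp
  have aug: "proj_vec n \<in> lin R (fm n) (rs (Q.fm n))"
  proof (rule linI, unfold restrict_scalars_simps)
    show "proj_vec n v \<in> carrier (Q.fm n)" if "v \<in> carrier (fm n)" for v by (rule pc[OF that])
    interpret F: Module.module R "fm n" by (rule fm_module)
    show "proj_vec n (v \<oplus>\<^bsub>fm n\<^esub> w) = proj_vec n v \<oplus>\<^bsub>Q.fm n\<^esub> proj_vec n w"
      if v: "v \<in> carrier (fm n)" and w: "w \<in> carrier (fm n)" for v w
    proof (rule Q.fm_eqI[where n = n])
      fix i assume i: "i < n"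
      show "proj_vec n (v \<oplus>\<^bsub>fm n\<^esub> w) i = (proj_vec n v \<oplus>\<^bsub>Q.fm n\<^esub> proj_vec n w) i"
        using i ring_hom_add[OF proj_hom fm_coord[OF v i] fm_coord[OF w i]]
        by (simp add: proj_vec_def fm_add Q.fm_add)
    qed (simp_all add: pc v w)
    show "proj_vec n (a \<odot>\<^bsub>fm n\<^esub> v) = proj a \<odot>\<^bsub>Q.fm n\<^esub> proj_vec n v"
      if a: "a \<in> carrier R" and v: "v \<in> carrier (fm n)" for a v
    proof (rule Q.fm_eqI[where n = n])
      fix i assume i: "i < n"
      show "proj_vec n (a \<odot>\<^bsub>fm n\<^esub> v) i = (proj a \<odot>\<^bsub>Q.fm n\<^esub> proj_vec n v) i"
        using i ring_hom_mult[OF proj_hom a fm_coord[OF v i]]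
        by (simp add: proj_vec_def fm_smult Q.fm_smult)
    qed (simp_all add: pc v a ring_hom_closed[OF proj_hom a])
  qed
  have onto: "proj_vec n ` carrier (fm n) = carrier (Q.fm n)"
  proof (intro equalityI subsetI)
    fix z assume "z \<in> proj_vec n ` carrier (fm n)"
    then show "z \<in> carrier (Q.fm n)" using pc by blast
  next
    fix z assume z: "z \<in> carrier (Q.fm n)"
    have "\<exists>r. r \<in> carrier R \<and> z i = proj r" if "i < n" for i
      using Q.fm_coord[OF z that] proj_onto by (metis imageE)
    then have "\<forall>i. \<exists>r. i < n \<longrightarrow> r \<in> carrier R \<and> z i = proj r" by blast
    from choice[OF this] obtain r where r: "\<forall>i. i < n \<longrightarrow> r i \<in> carrier R \<and> z i = proj (r i)" ..
    have rc: "restrict r {..<n} \<in> carrier (fm n)" using r by (intro fm_memI) simp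
    have "proj_vec n (restrict r {..<n}) = z"
      by (rule Q.fm_eqI[OF pc[OF rc] z]) (use r in \<open>simp add: proj_vec_def\<close>)
    then show "z \<in> proj_vec n ` carrier (fm n)" using rc by (metis imageI)
  qed
  have ker0: "proj_vec n v = \<zero>\<^bsub>Q.fm n\<^esub> \<longleftrightarrow> (\<forall>i<n. v i \<in> PIdl x)" if v: "v \<in> carrier (fm n)" for v
  proof -
    have "proj_vec n v = \<zero>\<^bsub>Q.fm n\<^esub> \<longleftrightarrow> (\<forall>i<n. proj_vec n v i = \<zero>\<^bsub>QR\<^esub>)"
      using Q.fm_eqI[OF pc[OF v] QF.M.zero_closed] by (auto simp: Q.fm_zero)
    also have "\<dots> \<longleftrightarrow> (\<forall>i<n. v i \<in> PIdl x)"
      using proj_zero_iff[OF fm_coord[OF v]] by (simp add: proj_vec_def)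
    finally show ?thesis .
  qed
  have ex0: "periodic_diff n 0 ` carrier (fm n) = a_kernel (fm n) (rs (Q.fm n)) (proj_vec n)"
    using ker0 by (auto simp: set_eq_iff a_kernel_def' restrict_scalars_simps periodic_diff_def
        scale_image[OF x_carrier])
  have ex: "periodic_diff n (Suc k) ` carrier (fm n) = a_kernel (fm n) (fm n) (periodic_diff n k)" for k
    by (auto simp: set_eq_iff a_kernel_def' periodic_diff_def scale_image[OF x_carrier] scale_image[OF y_carrier]
         scale_kernel[OF x_carrier] scale_kernel[OF y_carrier] ann_x ann_y)
  have d: "periodic_diff n k \<in> lin R (fm n) (fm n)" for k
    unfolding periodic_diff_def by (rule scale_lin) (simp add: x_carrier y_carrier)
  show ?thesis
    unfolding free_resolution_def using aug onto ex0 ex d by (simp add: restrict_scalars_simps)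
qed

text \<open>
  The four comparisons from the mapping cone of a lift of \<open>N \<rightarrow> R\<^sup>b\<close>. The syzygy \<open>N\<close> lives on
  vectors over the quotient ring, whatever the carrier type of \<open>M\<close>. This is why the induction below
  runs over modules of that type and treats \<open>M\<close> by one extra step.
\<close>

lemma syzygy_step:
  fixes M :: "('a set, 'c, 'm) module_scheme"
  assumes M: "Module.module QR M" and fg: "finitely_generated QR M"
  shows "\<exists>N :: ('a set, nat \<Rightarrow> 'a set) module.
    Module.module QR N \<and> finitely_generated QR N \<and> (\<forall>n. betti QR N n = betti QR M (Suc n)) \<and>
    betti R (rs M) 0 = betti QR M 0 \<and>
    (\<forall>n. betti R (rs M) (Suc n) \<le> betti QR M 0 + betti R (rs N) n) \<and>
    (\<forall>n. betti R (rs N) n \<le> betti R (rs M) (Suc n) + betti QR M 0) \<and>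
    betti R (rs N) 0 \<le> betti R (rs M) (Suc 0)"
proof -
  interpret Q: noetherian_local_ring QR by (rule QR_local)
  obtain b d \<epsilon> where min: "minimal_free_resolution QR M b d \<epsilon>"
    using Q.minimal_free_resolution_exists[OF M fg] by blast
  note res = minimal_is_resolution[OF min]
  note \<epsilon> = Q.resolution_aug[OF res] and d = Q.resolution_diff[OF res]
  let ?F = "Q.fm (b 0)"
  interpret QF: Module.module QR ?F by (rule Q.fm_module)
  define K where "K = d 0 ` carrier (Q.fm (b (Suc 0)))"
  have K_ker: "K = a_kernel ?F M \<epsilon>" using res by (simp add: K_def free_resolution_def)
  have Ksub: "LinearCombinations.submodule QR K ?F"
    unfolding K_ker by (rule kernel_submodule[OF Q.fm_module M \<epsilon>])
  have K_carrier: "K \<subseteq> carrier ?F" by (rule LinearCombinations.submodule.subset[OF Ksub])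
  define N where "N = ?F\<lparr>carrier := K\<rparr>"
  have N_simps: "carrier N = K" "add N = add ?F" "zero N = zero ?F" "smult N = smult ?F"
    by (simp_all add: N_def)
  have N: "Module.module QR N" unfolding N_def by (rule QF.submodule_is_module[OF Ksub])
  have d0: "d 0 \<in> lin QR (Q.fm (b (Suc 0))) N"
    using d[of 0] by (auto simp: LinearCombinations.module_hom_def N_simps K_def)
  have Nfg: "finitely_generated QR N"
    by (rule Q.finitely_generated_image[OF N d0]) (simp add: N_simps K_def)
  have "minimal_free_resolution QR N (\<lambda>n. b (Suc n)) (\<lambda>n. d (Suc n)) (d 0)"
    using min d0 by (simp add: minimal_free_resolution_def free_resolution_def N_simps K_def a_kernel_def')
  then have bettiN: "betti QR N n = betti QR M (Suc n)" for n
    using Q.betti_eq[OF _ N] Q.betti_eq[OF min M] by metis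
  have b0: "betti QR M 0 = b 0" by (rule Q.betti_eq[OF min M])
  note MS = rs_module[OF M] and NS = rs_module[OF N] and FS = rs_module[OF Q.fm_module]
  obtain p dP \<epsilon>P where Pmin: "minimal_free_resolution R (rs N) p dP \<epsilon>P"
    using minimal_free_resolution_exists[OF NS rs_fg[OF N Nfg]] by blast
  note P = minimal_is_resolution[OF Pmin]
  obtain t dT \<epsilon>T where Tmin: "minimal_free_resolution R (rs M) t dT \<epsilon>T"
    using minimal_free_resolution_exists[OF MS rs_fg[OF M fg]] by blast
  note T = minimal_is_resolution[OF Tmin]
  note per = periodic_resolution[of "b 0"]
  have \<iota>: "(\<lambda>v. v) \<in> lin R (rs N) (rs ?F)"
    by (rule linI) (use K_carrier in \<open>auto simp: restrict_scalars_simps N_simps\<close>)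
  have \<epsilon>P: "\<epsilon>P \<in> lin R (fm (p 0)) (rs ?F)" using lin_comp[OF resolution_aug[OF P] \<iota>] .
  have ker: "\<epsilon>P v = \<zero>\<^bsub>rs ?F\<^esub>" if "\<epsilon>P v = \<zero>\<^bsub>rs N\<^esub>" for v
    using that by (simp add: restrict_scalars_simps N_simps)
  obtain f where f: "\<And>n. f n \<in> lin R (fm (p n)) (fm (b 0))"
    "\<And>v. v \<in> carrier (fm (p 0)) \<Longrightarrow> proj_vec (b 0) (f 0 v) = \<epsilon>P v"
    "\<And>n v. v \<in> carrier (fm (p (Suc n))) \<Longrightarrow> periodic_diff (b 0) n (f (Suc n) v) = f n (dP n v)"
    using chain_map_exists[OF P per FS \<epsilon>P ker] by blast
  interpret C: local_resolution_map R "rs N" "rs ?F" p dP \<epsilon>P "\<lambda>_. b 0" "periodic_diff (b 0)"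
      "proj_vec (b 0)" "\<lambda>v. v" f
    by (intro local_resolution_map.intro resolution_map.intro resolution_map_axioms.intro is_cring
        noetherian_local_ring_axioms NS FS P per \<iota> f)
  have \<epsilon>S: "\<epsilon> \<in> lin R (rs ?F) (rs M)" by (rule lin_restrict_scalars[OF proj_hom \<epsilon>])
  have cone: "free_resolution R (rs M) C.cone_rank C.cone_diff (\<lambda>v. \<epsilon> (proj_vec (b 0) v))"
  proof (rule C.cone_resolution[OF MS \<epsilon>S])
    show "\<epsilon> ` carrier (rs ?F) = carrier (rs M)"
      using Q.resolution_aug_onto[OF res] by (simp add: restrict_scalars_simps)
    show "\<epsilon> v = \<zero>\<^bsub>rs M\<^esub> \<longleftrightarrow> v \<in> (\<lambda>v. v) ` carrier (rs N)" if "v \<in> carrier (rs ?F)" for v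
      using that by (simp add: restrict_scalars_simps N_simps K_ker a_kernel_def')
    show "v = \<zero>\<^bsub>rs N\<^esub>" if "v = \<zero>\<^bsub>rs ?F\<^esub>" for v
      using that by (simp add: restrict_scalars_simps N_simps)
  qed
  have f0m: "f 0 w \<in> fm_ideal mm (b 0)" if w: "w \<in> carrier (fm (p 0))" for w
  proof -
    have fc: "f 0 w \<in> carrier (fm (b 0))" by (rule lin_closed[OF f(1) w])
    have "\<epsilon>P w \<in> K" using lin_closed[OF resolution_aug[OF P] w] by (simp add: restrict_scalars_simps N_simps)
    then have "proj_vec (b 0) (f 0 w) \<in> Q.fm_ideal Q.mm (b 0)"
      using Q.minimal_diff_in_ideal[OF min] f(2)[OF w] by (auto simp: K_def)
    then have "proj (f 0 w i) \<in> Q.mm" if "i < b 0" for i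
      using that by (simp add: Q.fm_ideal_def proj_vec_def)
    then show ?thesis using proj_max fm_coord[OF fc] fc by (simp add: fm_ideal_def)
  qed
  have x0m: "periodic_diff (b 0) 0 u \<in> fm_ideal mm (b 0)" if u: "u \<in> carrier (fm (b 0))" for u
    using u scale_closed[OF x_carrier u] ideal.I_r_closed[OF max_ideal_ideal x_max] fm_coord[OF u]
    by (simp add: fm_ideal_def periodic_diff_def) (simp add: scale_def)
  have bp: "betti R (rs N) n = p n" and bt: "betti R (rs M) n = t n" for n
    using betti_eq[OF Pmin NS] betti_eq[OF Tmin MS] by simp_all
  have up: "t n \<le> C.cone_rank n" for n by (rule minimal_rank_le[OF Tmin cone MS])
  note ranks = C.cone_ranks[OF MS cone T minimal_diff_in_ideal[OF Pmin]]
  have "b 0 \<le> t 0" by (rule ranks(3)[OF _ f0m x0m])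
  then have "t 0 = b 0" using up[of 0] by (simp add: C.cone_rank_simps)
  moreover have "t (Suc n) \<le> b 0 + p n" for n using up[of "Suc n"] by (simp add: C.cone_rank_simps)
  moreover have "p n \<le> t (Suc n) + b 0" for n by (rule ranks(1))
  moreover have "p 0 \<le> t (Suc 0)" by (rule ranks(2)[OF _ f0m])
  ultimately show ?thesis using N Nfg bettiN b0 bp bt by (intro exI[of _ N]) simp
qed

text \<open>
  The two inequalities in subtraction-free form. For \<open>n = 0\<close> the truncated \<open>n - 1\<close> gives the
  empty sum, as it should.
\<close>

definition betti_bounds :: "('a set, 'c, 'm) module_scheme \<Rightarrow> nat \<Rightarrow> bool"
  where "betti_bounds M n \<longleftrightarrow>
    betti R (rs M) n \<le> (\<Sum>i\<le>n. betti QR M i) \<and>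
    betti QR M n \<le> betti R (rs M) n + (\<Sum>i<n - 1. betti QR M i)"

lemma betti_bounds_step:
  assumes M: "Module.module QR M" and fg: "finitely_generated QR M"
    and IH: "\<And>m (N :: ('a set, nat \<Rightarrow> 'a set) module). n = Suc m \<Longrightarrow> Module.module QR N \<Longrightarrow>
      finitely_generated QR N \<Longrightarrow> betti_bounds N m"
  shows "betti_bounds M n"
proof -
  from syzygy_step[OF M fg] obtain N :: "('a set, nat \<Rightarrow> 'a set) module"
    where N: "Module.module QR N" "finitely_generated QR N"
      and bN: "\<forall>n. betti QR N n = betti QR M (Suc n)"
      and b0: "betti R (rs M) 0 = betti QR M 0"
      and up: "\<forall>n. betti R (rs M) (Suc n) \<le> betti QR M 0 + betti R (rs N) n"
      and lo: "\<forall>n. betti R (rs N) n \<le> betti R (rs M) (Suc n) + betti QR M 0"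
      and lo0: "betti R (rs N) 0 \<le> betti R (rs M) (Suc 0)"
    by blast
  show ?thesis
  proof (cases n)
    case 0
    then show ?thesis using b0 by (simp add: betti_bounds_def)
  next
    case (Suc m)
    have bounds: "betti R (rs N) m \<le> (\<Sum>i\<le>m. betti QR M (Suc i))"
      "betti QR M (Suc m) \<le> betti R (rs N) m + (\<Sum>i<m - 1. betti QR M (Suc i))"
      using IH[OF Suc N] bN by (simp_all add: betti_bounds_def)
    have "betti R (rs M) n \<le> (\<Sum>i\<le>n. betti QR M i)"
      using up[rule_format, of m] bounds(1) by (simp add: Suc sum.atMost_Suc_shift del: sum.atMost_Suc)
    moreover have "betti QR M n \<le> betti R (rs M) n + (\<Sum>i<n - 1. betti QR M i)"
    proof (cases m)
      case 0
      then show ?thesis using bounds(2) lo0 Suc by simp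
    next
      case (Suc l)
      then show ?thesis
        using bounds(2) lo[rule_format, of m] \<open>n = Suc m\<close>
        by (simp add: sum.lessThan_Suc_shift del: sum.lessThan_Suc)
    qed
    ultimately show ?thesis by (simp add: betti_bounds_def)
  qed
qed

lemma betti_bounds_syzygy:
  fixes N :: "('a set, nat \<Rightarrow> 'a set) module"
  assumes "Module.module QR N" "finitely_generated QR N"
  shows "betti_bounds N n"
  using assms
proof (induction n arbitrary: N)
  case 0
  show ?case by (rule betti_bounds_step[OF 0]) simp
next
  case (Suc n)
  show ?case by (rule betti_bounds_step[OF Suc.prems]) (use Suc.IH in simp)
qed

lemma betti_bounds:
  assumes "Module.module QR M" "finitely_generated QR M" shows "betti_bounds M n"
  by (rule betti_bounds_step[OF assms betti_bounds_syzygy])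

end

section \<open>Complexity\<close>

text \<open>
  Summation raises the exponent by one. The exponent \<open>-1\<close> needs its own argument, because the sums
  of \<open>a/n\<close> are unbounded: a natural number at most \<open>a/n\<close> is zero once \<open>n\<close> exceeds \<open>a\<close>, so
  the sequence of sums is eventually constant.
\<close>

lemma polynomial_growth_sum:
  fixes b c :: "nat \<Rightarrow> nat"
  assumes c: "\<And>n. c n \<le> (\<Sum>i\<le>n. b i)"
    and b: "\<forall>n\<ge>1. real (b n) \<le> a * real n powi (int t - 1)"
  shows "\<exists>a'::real. \<forall>n\<ge>1. real (c n) \<le> a' * real n powi (int (Suc t) - 1)"
proof (cases t)
  case 0
  define K where "K = nat \<lceil>\<bar>a\<bar>\<rceil>"
  have b0: "b n = 0" if n: "K < n" for n
  proof -
    have "\<bar>a\<bar> < real n" using n unfolding K_def by linarith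
    moreover have "real (b n) \<le> a / real n" using b n 0 by (simp add: power_int_minus divide_inverse)
    moreover have "a / real n \<le> \<bar>a\<bar> / real n" by (intro divide_right_mono) auto
    ultimately have "real (b n) < 1" using n by (smt (verit) divide_less_eq_1_pos)
    then show ?thesis by simp
  qed
  have "c n \<le> (\<Sum>i\<le>K. b i)" for n
  proof -
    have "(\<Sum>i\<le>n. b i) \<le> (\<Sum>i\<le>max n K. b i)" by (rule sum_mono2) auto
    also have "\<dots> = (\<Sum>i\<le>K. b i)" using b0 by (intro sum.mono_neutral_right) auto
    finally show ?thesis using c[of n] by simp
  qed
  then show ?thesis using 0 by (intro exI[of _ "real (\<Sum>i\<le>K. b i)"]) (simp del: of_nat_sum)
next
  case (Suc s)
  have "real (c n) \<le> (real (b 0) + \<bar>a\<bar>) * real n ^ t" if n: "1 \<le> n" for n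
  proof -
    have bi: "real (b i) \<le> \<bar>a\<bar> * real n ^ s" if i: "i \<in> {1..n}" for i
    proof -
      have "real (b i) \<le> a * real i ^ s" using b i Suc by simp
      also have "\<dots> \<le> \<bar>a\<bar> * real n ^ s"
        using i by (intro mult_mono power_mono) auto
      finally show ?thesis .
    qed
    have "real (c n) \<le> (\<Sum>i\<le>n. real (b i))" using c[of n] by (metis of_nat_le_iff of_nat_sum)
    also have "{..n} = insert 0 {1..n}" by auto
    also have "(\<Sum>i\<in>insert 0 {1..n}. real (b i)) = real (b 0) + (\<Sum>i\<in>{1..n}. real (b i))" by simp
    also have "(\<Sum>i\<in>{1..n}. real (b i)) \<le> (\<Sum>i\<in>{1..n}. \<bar>a\<bar> * real n ^ s)"
      by (rule sum_mono[OF bi])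
    also have "\<dots> = \<bar>a\<bar> * real n ^ t" by (simp add: Suc)
    also have "real (b 0) \<le> real (b 0) * real n ^ t"
      using one_le_power[of "real n" t] n by (simp add: mult_le_cancel_left1)
    finally show ?thesis by (simp add: algebra_simps)
  qed
  then show ?thesis by (intro exI[of _ "real (b 0) + \<bar>a\<bar>"]) simp
qed

lemma complexity_le_Suc:
  assumes "\<And>n. betti A X n \<le> (\<Sum>i\<le>n. betti B Y i)"
  shows "complexity A X \<le> complexity B Y + 1"
proof -
  let ?S = "{enat t | t. \<exists>a::real. \<forall>n\<ge>1. real (betti B Y n) \<le> a * real n powi (int t - 1)}"
  show ?thesis
  proof (cases "?S = {}")
    case True
    then show ?thesis unfolding complexity_def by (simp add: Inf_enat_def)
  next
    case False
    then have "Inf ?S \<in> ?S" by (metis (no_types, lifting) Inf_enat_def LeastI ex_in_conv)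
    then obtain t a where t: "Inf ?S = enat t"
      "\<forall>n\<ge>1. real (betti B Y n) \<le> a * real n powi (int t - 1)" by blast
    from polynomial_growth_sum[OF assms t(2)]
    have "complexity A X \<le> enat (Suc t)" unfolding complexity_def by (intro Inf_lower) blast
    then show ?thesis using t(1) by (simp add: complexity_def one_enat_def)
  qed
qed

theorem corollary3p6:
  fixes S :: "('a, 'r) ring_scheme" and x :: 'a
    and R :: "'a set ring"
    and M :: "('a set, 'b, 'm) module_scheme"
    and M\<^sub>S :: "('a, 'b) module"
  assumes "noetherian_local_ring S"
    and "exact_zero_divisor S x"
    and R_def: "R = S Quot (PIdl\<^bsub>S\<^esub> x)"
    and "Module.module R M" and "finitely_generated R M"
    and M\<^sub>S_def: "M\<^sub>S = restrict_scalars (\<lambda>s. PIdl\<^bsub>S\<^esub> x +>\<^bsub>S\<^esub> s) M"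
  shows "(\<forall>n. int (betti R M n) - (\<Sum>i | i + 2 \<le> n. int (betti R M i)) \<le> int (betti S M\<^sub>S n) \<and>
              betti S M\<^sub>S n \<le> (\<Sum>i\<le>n. betti R M i)) \<and>
         complexity S M\<^sub>S \<le> complexity R M + 1"
proof -
  obtain y where "y \<in> carrier S" "annihilator S x = PIdl\<^bsub>S\<^esub> y" "annihilator S y = PIdl\<^bsub>S\<^esub> x"
    "x \<in> max_ideal S"
    using assms(2) by (auto simp: exact_zero_divisor_def)
  then interpret exact_pair S x y
    using assms(1) by (intro exact_pair.intro exact_pair_axioms.intro)
  have bounds: "betti S M\<^sub>S n \<le> (\<Sum>i\<le>n. betti R M i)"
    "betti R M n \<le> betti S M\<^sub>S n + (\<Sum>i<n - 1. betti R M i)" for n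
    using betti_bounds[of M n] assms(4,5) by (simp_all add: betti_bounds_def R_def M\<^sub>S_def)
  have "int (betti R M n) - (\<Sum>i | i + 2 \<le> n. int (betti R M i)) \<le> int (betti S M\<^sub>S n)" for n
  proof -
    have "{i. i + 2 \<le> n} = {..<n - 1}" by auto
    then show ?thesis using bounds(2)[of n] by (simp flip: of_nat_sum)
  qed
  then show ?thesis using bounds(1) complexity_le_Suc[OF bounds(1)] by blast
qed

end
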